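(* There exist an infinite set $S\subset\overline{\mathbb{Q}}$ with finite Northcott number, and $E_S\in\mathbb{N}$, such that for every number field $K$ and every finite extension $L/K$ with $L\subset K(S)$, we have $e(\mathfrak{B}/\mathfrak{B}\cap K)\leq E_S$ for every prime ideal $\mathfrak{B}$ in $\mathcal{O}_L$.
   Context: $\mathcal{O}_L$ is the ring of integers of $L$; $e(\mathfrak{B}/\mathfrak{B}\cap K)$ is the ramification index of the (non-zero) prime ideal $\mathfrak{B}$ over the prime of $\mathcal{O}_K$ below it. Northcott number. $h_\infty$ is the absolute logarithmic Weil height on $\overline{\mathbb{Q}}$. For a set $S$ of algebraic numbers, $m(S)=\inf\{t: \{x\in S: h_\infty(x)\le t\}\text{ is infinite}\}$ is the Northcott number of $S$. *)

theory Defs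
  imports
    "HOL-Analysis.Analysis"
    "HOL-Algebra.Algebra"
    "HOL-Algebra.Algebraic_Closure_Type"
begin

text \<open>
  All fields live inside the complex numbers, and the field of algebraic numbers is
  the set of complex numbers satisfying \<^const>\<open>algebraic\<close>.
\<close>

abbreviation complex_field :: "complex ring" where
  "complex_field \<equiv> ring_of_type_algebra"

definition number_field :: "complex set \<Rightarrow> bool" where
  "number_field K \<longleftrightarrow>
     subfield K complex_field \<and> ring.finite_dimension complex_field \<rat> K"

definition finite_field_extension :: "complex set \<Rightarrow> complex set \<Rightarrow> bool" where
  "finite_field_extension K L \<longleftrightarrow>
     subfield K complex_field \<and> subfield L complex_field \<and> K \<subseteq> L \<and>
     ring.finite_dimension complex_field K L"

definition ring_of_integers :: "complex set \<Rightarrow> complex ring" where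
  "ring_of_integers K = complex_field \<lparr>carrier := {x \<in> K. algebraic_int x}\<rparr>"

definition nonzero_primes :: "complex set \<Rightarrow> complex set set" where
  "nonzero_primes K = {P. primeideal P (ring_of_integers K) \<and> P \<noteq> {0}}"

text \<open>
  The exponent of \<open>P\<close> in the factorisation of the ideal \<open>I\<close>, i.e. the largest \<open>n\<close> such
  that \<open>P\<^sup>n\<close> divides \<open>I\<close>.  Being an extended natural number, it is \<open>\<infinity>\<close> (and not some
  unspecified number) if there is no largest \<open>n\<close>, e.g. for \<open>I = 0\<close>.
\<close>
definition ideal_exponent :: "'a ring \<Rightarrow> 'a set \<Rightarrow> 'a set \<Rightarrow> enat" where
  "ideal_exponent R P I =
     Sup {enat n | n. \<exists>J. ideal J R \<and> I = (P [^]\<^bsub>ideals_set R\<^esub> n) \<cdot>\<^bsub>R\<^esub> J}"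

text \<open>
  For a prime \<open>B\<close> of the ring of integers of \<open>L\<close>, the intersection \<open>B \<inter> K\<close> is the prime of
  the ring of integers of \<open>K\<close> below \<open>B\<close>.
\<close>
definition ramification_index :: "complex set \<Rightarrow> complex set \<Rightarrow> complex set \<Rightarrow> enat" where
  "ramification_index K L B =
     ideal_exponent (ring_of_integers L) B (Idl\<^bsub>ring_of_integers L\<^esub> (B \<inter> K))"

text \<open>
  The finite places of \<open>K\<close> are normalised as \<open>|x|\<^sub>P = N(P) ^ (- v\<^sub>P(x))\<close>, i.e. the exponent
  given by the local degree is included.  The value on \<open>K\<close> does not depend on the chosen
  representation of \<open>x\<close> as a quotient of integers.
\<close>
definition adic_abs_int :: "complex set \<Rightarrow> complex set \<Rightarrow> complex \<Rightarrow> real" where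
  "adic_abs_int K P a =
     (if a = 0 then 0
      else 1 / real (card (carrier (ring_of_integers K Quot P)))
               ^ the_enat (ideal_exponent (ring_of_integers K) P (PIdl\<^bsub>ring_of_integers K\<^esub> a)))"

definition adic_abs :: "complex set \<Rightarrow> complex set \<Rightarrow> complex \<Rightarrow> real" where
  "adic_abs K P x =
     (let (a, b) = (SOME (a, b). a \<in> carrier (ring_of_integers K) \<and>
                                 b \<in> carrier (ring_of_integers K) \<and> b \<noteq> 0 \<and> x = a / b)
      in adic_abs_int K P a / adic_abs_int K P b)"

text \<open>
  Restriction to \<^const>\<open>extensional\<close> functions makes an embedding determined by its values
  on \<open>K\<close>, so that each embedding is counted once.
\<close>
definition embeddings :: "complex set \<Rightarrow> (complex \<Rightarrow> complex) set" where
  "embeddings K = ring_hom (complex_field \<lparr>carrier := K\<rparr>) complex_field \<inter> extensional K"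

text \<open>
  The absolute logarithmic Weil height
  \<open>[K : \<rat>]\<^sup>-\<^sup>1 \<Sum>\<^sub>v d\<^sub>v log max {1, |x|\<^sub>v}\<close> of \<open>x \<in> K\<close>, the sum being over all places \<open>v\<close> of
  \<open>K\<close>, with local degrees \<open>d\<^sub>v\<close>.  Summing over all embeddings (instead of all archimedean
  places) counts each complex place twice, as prescribed by its local degree.  The infinite sum
  has only finitely many non-zero terms.
\<close>
definition weil_height_over :: "complex set \<Rightarrow> complex \<Rightarrow> real" where
  "weil_height_over K x =
     ((\<Sum>\<sigma>\<in>embeddings K. ln (max 1 (norm (\<sigma> x)))) +
      (\<Sum>\<^sub>\<infinity>P\<in>nonzero_primes K. ln (max 1 (adic_abs K P x)))) /
     real (ring.dim complex_field \<rat> K)"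

text \<open>
  The height does not depend on the number field containing \<open>x\<close>; we take \<open>\<rat>(x)\<close>.
\<close>
definition weil_height :: "complex \<Rightarrow> real" where
  "weil_height x = weil_height_over (generate_field complex_field {x}) x"

text \<open>Extended-real valued, since the infimum of the empty set is \<open>\<infinity>\<close>.\<close>
definition northcott_number :: "complex set \<Rightarrow> ereal" where
  "northcott_number S = Inf {ereal t | t. infinite {x \<in> S. weil_height x \<le> t}}"

end

theory Submission
  imports Defs
begin

text \<open>
  Let \<open>S\<close> be the set of all roots of the trinomials \<open>T\<^sup>n - T - 1\<close>, \<open>n \<ge> 2\<close>.  The roots are units
  all of whose conjugates have absolute value at most 2, so their heights are at most \<open>ln 2\<close>.

  For the ramification, let \<open>V\<close> be a valuation ring of the complex numbers whose maximal ideal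
  \<open>M\<close> lies above the given prime \<open>B\<close> of \<open>L\<close>, and let \<open>c\<close> be a uniformiser of \<open>K\<close> with respect to
  \<open>V\<close>.  By Zorn's lemma there is a maximal field \<open>U \<supseteq> K\<close> of algebraic numbers that still has \<open>c\<close>
  as a uniformiser; it contains all roots of polynomials over \<open>U \<inter> V\<close> that are simple modulo
  \<open>M\<close>.  Modulo \<open>M\<close> a trinomial has at most one multiple root, which is a double root and
  does not occur in residue characteristic 2.  If \<open>x\<close> and \<open>y\<close> are the two roots that reduce to it,
  then all other roots lie in \<open>U\<close>, hence so do \<open>x + y\<close> and \<open>x y\<close>, and \<open>x\<close> is quadratic over
  \<open>U\<close>.  As square roots of units are in \<open>U\<close>, all of \<open>K(S)\<close> is contained in \<open>U(\<surd>c)\<close>, so that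
  \<open>c\<close> divides \<open>b\<^sup>2\<close> in \<open>V\<close> for all \<open>b \<in> B\<close>.  This contradicts \<open>c \<in> B\<^sup>3\<close>.
\<close>

hide_const (open) Divisibility.prime up_ring.coeff up_ring.monom Polynomials.degree Polynomials.lead_coeff module.smult

section \<open>Subrings and extensions of valuation rings\<close>

text \<open>Everything takes place inside one valuation ring \<open>V\<close> of the complex
  numbers, so no valuation has to be extended from a subfield to a larger field. There is no value
  function: two elements have equal value if their quotient is in \<open>units\<close>, and a
  valuation is discrete on a field if the nonzero elements are units times powers of one
  \<open>c\<close>. The obstacle is that infinitely many quadratic extensions could together be
  arbitrarily ramified; since \<open>U\<close> has the square roots of its units outside residue
  characteristic 2, they all collapse into a single one. \<open>U\<close> need not be a strict
  henselisation: maximality is enough, because adjoining a root that is simple modulo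
  \<open>M\<close> keeps \<open>c\<close> a uniformiser. The trinomials are chosen because
  \<open>z f'(z)\<close> is linear in \<open>z\<close> on the roots of
  \<open>f = T^n - T - 1\<close>, which pins down the residue of a multiple root. Subrings are plain
  sets of a field type, so that type-based polynomials apply; the algebra-library notions are
  translated only later.\<close>

locale sring =
  fixes A :: "'a::field set"
  assumes one_mem [simp]: "1 \<in> A"
    and diff_mem: "x \<in> A \<Longrightarrow> y \<in> A \<Longrightarrow> x - y \<in> A"
    and mult_mem: "x \<in> A \<Longrightarrow> y \<in> A \<Longrightarrow> x * y \<in> A"
begin

lemma zero_mem [simp]: "0 \<in> A"
  using diff_mem[OF one_mem one_mem] by simp

lemma uminus_mem: "x \<in> A \<Longrightarrow> - x \<in> A"
  using diff_mem[of 0 x] by simp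

lemma add_mem: "x \<in> A \<Longrightarrow> y \<in> A \<Longrightarrow> x + y \<in> A"
  using diff_mem[of x "- y"] uminus_mem by simp

lemma power_mem: "x \<in> A \<Longrightarrow> x ^ n \<in> A"
  by (induction n) (auto intro: mult_mem)

lemma sum_mem: "(\<And>i. i \<in> I \<Longrightarrow> f i \<in> A) \<Longrightarrow> sum f I \<in> A"
  by (induction I rule: infinite_finite_induct) (auto intro: add_mem)

lemma of_nat_mem [simp]: "of_nat n \<in> A"
  by (induction n) (auto intro: add_mem)

lemma of_int_mem [simp]: "of_int n \<in> A"
  by (cases n) (auto intro: diff_mem uminus_mem simp del: of_nat_Suc)

lemma numeral_mem [simp]: "numeral n \<in> A"
  using of_nat_mem[of "numeral n"] by simp

end

text \<open>Coefficients may range over any set, since besides subrings it is also applied to ideals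
  such as \<open>ideal_span A P\<close> and \<open>M\<close>.\<close>

definition polys :: "'a::zero set \<Rightarrow> 'a poly set" where
  "polys A = {p. \<forall>i. coeff p i \<in> A}"

lemma polysD: "p \<in> polys A \<Longrightarrow> coeff p i \<in> A"
  by (simp add: polys_def)

lemma polys_mono: "A \<subseteq> B \<Longrightarrow> polys A \<subseteq> polys B"
  by (auto simp: polys_def)

lemma monom_polys: "0 \<in> A \<Longrightarrow> c \<in> A \<Longrightarrow> monom c n \<in> polys A"
  by (auto simp: polys_def)

lemma reflect_polys: "0 \<in> A \<Longrightarrow> p \<in> polys A \<Longrightarrow> reflect_poly p \<in> polys A"
  by (auto simp: polys_def coeff_reflect_poly)

context sring
begin

lemma polys_0 [simp]: "0 \<in> polys A" and polys_1 [simp]: "1 \<in> polys A"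
  by (auto simp: polys_def Polynomial.coeff_1)

lemma polys_add: "p \<in> polys A \<Longrightarrow> q \<in> polys A \<Longrightarrow> p + q \<in> polys A"
  by (auto simp: polys_def intro: add_mem)

lemma polys_diff: "p \<in> polys A \<Longrightarrow> q \<in> polys A \<Longrightarrow> p - q \<in> polys A"
  by (auto simp: polys_def intro: diff_mem)

lemma polys_mult: "p \<in> polys A \<Longrightarrow> q \<in> polys A \<Longrightarrow> p * q \<in> polys A"
  by (auto simp: polys_def coeff_mult intro!: sum_mem mult_mem)

lemma polys_smult: "c \<in> A \<Longrightarrow> q \<in> polys A \<Longrightarrow> smult c q \<in> polys A"
  by (auto simp: polys_def intro!: mult_mem)

lemma polys_pCons: "c \<in> A \<Longrightarrow> q \<in> polys A \<Longrightarrow> pCons c q \<in> polys A"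
  by (auto simp: polys_def coeff_pCons split: nat.splits)

lemma polys_pderiv: "q \<in> polys A \<Longrightarrow> pderiv q \<in> polys A"
  by (auto simp: polys_def coeff_pderiv simp del: of_nat_Suc intro!: mult_mem)

lemma poly_mem: "p \<in> polys A \<Longrightarrow> x \<in> A \<Longrightarrow> poly p x \<in> A"
  by (auto simp: polys_def poly_altdef intro!: sum_mem mult_mem power_mem)

definition adjoin :: "'a \<Rightarrow> 'a set" where
  "adjoin x = (\<lambda>p. poly p x) ` polys A"

lemma sring_adjoin: "sring (adjoin x)"
proof
  show "1 \<in> adjoin x"
    unfolding adjoin_def by (rule image_eqI[of _ _ 1]) auto
next
  fix a b assume "a \<in> adjoin x" "b \<in> adjoin x"
  then obtain p q where pq: "p \<in> polys A" "q \<in> polys A" "a = poly p x" "b = poly q x"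
    unfolding adjoin_def by auto
  show "a - b \<in> adjoin x"
    unfolding adjoin_def by (rule image_eqI[of _ _ "p - q"]) (use pq polys_diff in auto)
  show "a * b \<in> adjoin x"
    unfolding adjoin_def by (rule image_eqI[of _ _ "p * q"]) (use pq polys_mult in auto)
qed

lemma subset_adjoin: "A \<subseteq> adjoin x"
proof
  fix a assume "a \<in> A"
  then show "a \<in> adjoin x"
    unfolding adjoin_def by (intro image_eqI[of _ _ "[:a:]"]) (auto intro: polys_pCons)
qed

lemma mem_adjoin: "x \<in> adjoin x"
  unfolding adjoin_def by (intro image_eqI[of _ _ "[:0,1:]"]) (auto intro!: polys_pCons)

end

text \<open>The generators \<open>P\<close> are a separate parameter because in the Zorn argument
  the ring grows while \<open>P\<close> stays fixed.\<close>

inductive_set ideal_span :: "'a::field set \<Rightarrow> 'a set \<Rightarrow> 'a set" for A P where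
  zero: "0 \<in> ideal_span A P"
| step: "p \<in> P \<Longrightarrow> a \<in> A \<Longrightarrow> z \<in> ideal_span A P \<Longrightarrow> p * a + z \<in> ideal_span A P"

context sring
begin

lemma ideal_span_add:
  "x \<in> ideal_span A P \<Longrightarrow> y \<in> ideal_span A P \<Longrightarrow> x + y \<in> ideal_span A P"
  by (induction rule: ideal_span.induct) (auto simp: add.assoc intro: ideal_span.intros)

lemma ideal_span_mult:
  "x \<in> ideal_span A P \<Longrightarrow> y \<in> A \<Longrightarrow> x * y \<in> ideal_span A P"
  by (induction rule: ideal_span.induct)
     (auto simp: distrib_right mult.assoc intro!: ideal_span.intros mult_mem)

lemma ideal_span_diff:
  "x \<in> ideal_span A P \<Longrightarrow> y \<in> ideal_span A P \<Longrightarrow> x - y \<in> ideal_span A P"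
  using ideal_span_add[of x P "y * (- 1)"] ideal_span_mult[of y P "- 1"] uminus_mem[of 1] by simp

lemma ideal_span_sum: "(\<And>i. i \<in> I \<Longrightarrow> f i \<in> ideal_span A P) \<Longrightarrow> sum f I \<in> ideal_span A P"
  by (induction I rule: infinite_finite_induct) (auto intro: ideal_span_add ideal_span.zero)

lemma poly_ideal_span:
  "p \<in> polys (ideal_span A P) \<Longrightarrow> x \<in> A \<Longrightarrow> poly p x \<in> ideal_span A P"
  by (auto simp: polys_def poly_altdef intro!: ideal_span_sum ideal_span_mult power_mem)

lemma polys_ideal_span_mult:
  "p \<in> polys (ideal_span A P) \<Longrightarrow> q \<in> polys A \<Longrightarrow> p * q \<in> polys (ideal_span A P)"
  by (auto simp: polys_def coeff_mult intro!: ideal_span_sum ideal_span_mult)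

lemma ideal_span_subset: "P \<subseteq> A \<Longrightarrow> ideal_span A P \<subseteq> A"
proof
  fix x assume "P \<subseteq> A" "x \<in> ideal_span A P"
  from this(2,1) show "x \<in> A"
    by (induction rule: ideal_span.induct) (auto intro!: add_mem mult_mem)
qed

text \<open>Collecting powers of \<open>x\<close> lets the coefficients absorb the generators. This
  turns \<open>1\<close> lying in the extended ideal into a polynomial relation for
  \<open>x\<close>.\<close>

lemma ideal_span_adjoin:
  assumes "z \<in> ideal_span (adjoin x) P"
  shows "\<exists>q\<in>polys (ideal_span A P). poly q x = z"
  using assms
proof (induction rule: ideal_span.induct)
  case zero
  then show ?case by (intro bexI[of _ 0]) (auto simp: polys_def ideal_span.zero)
next
  case (step p a z)
  then obtain r q where r: "r \<in> polys A" "a = poly r x" "q \<in> polys (ideal_span A P)" "poly q x = z"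
    unfolding adjoin_def by auto
  have "smult p r + q \<in> polys (ideal_span A P)"
    using r step(1) by (auto simp: polys_def intro!: ideal_span.step)
  then show ?case using r by (intro bexI[of _ "smult p r + q"]) auto
qed

text \<open>Modulo the ideal, \<open>1 - d\<close> is \<open>1\<close>, hence so are its
  powers.\<close>

lemma power_one_minus:
  assumes "d \<in> ideal_span A P" "P \<subseteq> A"
  shows "1 - (1 - d) ^ n \<in> ideal_span A P"
proof (induction n)
  case 0
  then show ?case by (simp add: ideal_span.zero)
next
  case (Suc n)
  have "1 - (1 - d) ^ Suc n = (1 - (1 - d) ^ n) * (1 - d) + d" by (simp add: algebra_simps)
  moreover have "1 - d \<in> A" using ideal_span_subset assms diff_mem one_mem by blast
  ultimately show ?case using ideal_span_add ideal_span_mult Suc assms by metis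
qed

end

section \<open>Valuation rings and Chevalley's extension theorem\<close>

locale valring = sring V for V :: "'a::field set" +
  assumes total: "x \<in> V \<or> inverse x \<in> V"

text \<open>The core of Chevalley's theorem. The relation of smaller degree, say the one for
  \<open>1/x\<close>, expresses a power of \<open>x\<close> by lower powers; substituting this in
  the other relation lowers its degree, and the sum of the degrees cannot descend forever.\<close>

lemma mutual_reduction:
  fixes x :: "'a::field"
  assumes "sring A" "1 \<notin> ideal_span A P" and PA: "P \<subseteq> A"
    and units: "\<And>d. d \<in> ideal_span A P \<Longrightarrow> inverse (1 - d) \<in> A"
    and "x \<noteq> 0" "q \<in> polys (ideal_span A P)" "r \<in> polys (ideal_span A P)"
      "poly q x = 1" "poly r (inverse x) = 1"
  shows False
  using assms(5-)
proof (induction "degree q + degree r" arbitrary: q r x rule: less_induct)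
  case less
  interpret sring A by fact
  define I where "I = ideal_span A P"
  have "\<exists>q2 \<in> polys I. degree q2 < degree q \<and> poly q2 x = 1"
    if x: "x \<noteq> 0" and q: "q \<in> polys I" and r: "r \<in> polys I"
      and px: "poly q x = 1" "poly r (inverse x) = 1" and le: "degree r \<le> degree q"
    for q r :: "'a poly" and x
  proof -
    obtain d0 r1 where rc: "r = pCons d0 r1" by (cases r) auto
    have d0: "d0 \<in> I" using polysD[OF r, of 0] by (simp add: rc)
    have r1: "r1 \<in> polys I" using r by (auto simp: polys_def rc coeff_pCons split: nat.splits dest: spec[of _ "Suc _"])
    define u where "u = inverse (1 - d0)"
    have u: "u \<in> A" using units d0 by (simp add: u_def I_def)
    have d1: "1 - d0 \<noteq> 0" using d0 assms(2) by (auto simp: I_def)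
    have e: "1 - d0 = inverse x * poly r1 (inverse x)" using px(2) by (simp add: rc algebra_simps)
    then have "r1 \<noteq> 0" using d1 by auto
    define m where "m = degree r"
    have m: "m = Suc (degree r1)" using \<open>r1 \<noteq> 0\<close> by (simp add: m_def rc)
    \<comment> \<open>\<open>r(1/x) = 1\<close> is multiplied by \<open>x^m\<close>. The constant
      term \<open>d0\<close> moves to the left, and since \<open>1 - d0\<close> is a unit of
      \<open>A\<close>, \<open>x^m\<close> becomes a polynomial in \<open>x\<close> of degree below
      \<open>m\<close>.\<close>
    have "x ^ m * (1 - d0) = poly (reflect_poly r1) x"
      using poly_reflect_poly_nz[OF x, of r1] x e by (simp add: m)
    then have xm: "x ^ m = u * poly (reflect_poly r1) x"
      using d1 by (simp add: u_def field_simps)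
    define n where "n = degree q"
    define c where "c = coeff q n"
    define q2 where "q2 = (q - monom c n) + monom c (n - m) * smult u (reflect_poly r1)"
    have nm: "m \<le> n" using le by (simp add: m_def n_def)
    have "poly q2 x = poly q x - c * x ^ n + c * x ^ (n - m) * x ^ m"
      by (simp add: q2_def poly_monom xm)
    also have "\<dots> = 1" using nm px by (simp flip: power_add)
    finally have 1: "poly q2 x = 1" .
    have a: "degree (q - monom c n) < n"
    proof -
      have "degree (q - monom c n) \<le> n" by (intro degree_diff_le) (auto simp: n_def degree_monom_le)
      moreover have "coeff (q - monom c n) n = 0" by (simp add: c_def)
      ultimately show ?thesis using m nm
        by (metis eq_zero_or_degree_less degree_0 less_le_trans zero_less_Suc)
    qed
    have "degree (monom c (n - m) * smult u (reflect_poly r1)) \<le> (n - m) + degree r1"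
      by (rule order.trans[OF degree_mult_le])
        (intro add_mono degree_monom_le order.trans[OF degree_smult_le] degree_reflect_poly_le)
    with a nm m have 2: "degree q2 < degree q"
      unfolding q2_def n_def[symmetric] by (intro degree_add_less) auto
    have I0: "0 \<in> I" by (simp add: I_def ideal_span.zero)
    have cI: "c \<in> I" using q by (auto simp: c_def polys_def)
    have t1: "q - monom c n \<in> polys I"
      using q cI I0 unfolding polys_def I_def by (auto intro!: ideal_span_diff)
    have "reflect_poly r1 \<in> polys A"
      using r1 polys_mono[OF ideal_span_subset[OF PA]] by (auto simp: I_def intro!: reflect_polys)
    then have "monom c (n - m) * smult u (reflect_poly r1) \<in> polys I"
      unfolding I_def using u cI by (intro polys_ideal_span_mult monom_polys polys_smult)
        (auto simp: I_def ideal_span.zero)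
    then have 3: "q2 \<in> polys I"
      using t1 ideal_span_add unfolding q2_def polys_def I_def mem_Collect_eq coeff_add by blast
    show ?thesis using 1 2 3 by blast
  qed note red = this
  show False
  proof (cases "degree r \<le> degree q")
    case True
    then obtain q2 where "q2 \<in> polys I" "degree q2 < degree q" "poly q2 x = 1"
      using red[of x q r] less.prems by (auto simp: I_def)
    then show False using less.hyps[of q2 r x] less.prems by (auto simp: I_def)
  next
    case False
    then obtain q2 where "q2 \<in> polys I" "degree q2 < degree r" "poly q2 (inverse x) = 1"
      using red[of "inverse x" r q] less.prems by (auto simp: I_def)
    then show False using less.hyps[of q q2 x] less.prems by (auto simp: I_def)
  qed
qed

text \<open>Chevalley's theorem: a ring maximal among those in which \<open>P\<close> still
  generates a proper ideal is a valuation ring. The last conclusion says that \<open>P\<close> ends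
  up in its maximal ideal.\<close>

theorem valring_extension:
  fixes A0 :: "'a::field set"
  assumes "sring A0" "P \<subseteq> A0" "1 \<notin> ideal_span A0 P"
  obtains V where "valring V" "A0 \<subseteq> V" "\<And>p. p \<in> P \<Longrightarrow> p \<noteq> 0 \<Longrightarrow> inverse p \<notin> V"
proof -
  define S where "S = {A. sring A \<and> A0 \<subseteq> A \<and> 1 \<notin> ideal_span A P}"
  have "\<exists>M\<in>S. \<forall>D\<in>S. M \<subseteq> D \<longrightarrow> D = M"
  proof (rule subset_Zorn_nonempty)
    show "S \<noteq> {}" using assms by (auto simp: S_def)
  next
    fix C assume C: "C \<noteq> {}" "subset.chain S C"
    have two: "\<exists>A\<in>C. x \<in> A \<and> y \<in> A" if "x \<in> \<Union>C" "y \<in> \<Union>C" for x y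
    proof -
      from that obtain B D where "B \<in> C" "D \<in> C" "x \<in> B" "y \<in> D" by auto
      moreover have "B \<subseteq> D \<or> D \<subseteq> B" using C calculation by (auto simp: subset_chain_def)
      ultimately show ?thesis by blast
    qed
    have CS: "\<And>A. A \<in> C \<Longrightarrow> A \<in> S" using C by (auto simp: subset_chain_def)
    have "sring (\<Union>C)"
    proof
      show "1 \<in> \<Union>C" using C CS by (force simp: S_def intro: sring.one_mem)
    next
      fix x y assume "x \<in> \<Union>C" "y \<in> \<Union>C"
      then obtain A where "A \<in> C" "x \<in> A" "y \<in> A" using two by blast
      then show "x - y \<in> \<Union>C" "x * y \<in> \<Union>C"
        using CS[of A] by (auto simp: S_def intro: sring.diff_mem sring.mult_mem)
    qed
    moreover have "A0 \<subseteq> \<Union>C" using C CS by (auto simp: S_def)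
    moreover have "\<exists>A\<in>C. z \<in> ideal_span A P" if "z \<in> ideal_span (\<Union>C) P" for z
      using that
    proof (induction rule: ideal_span.induct)
      case zero
      then show ?case using C by (auto intro: ideal_span.zero)
    next
      case (step p a z)
      then obtain B D where XY: "B \<in> C" "D \<in> C" "a \<in> B" "z \<in> ideal_span D P" by auto
      have mono: "ideal_span A P \<subseteq> ideal_span B P" if "A \<subseteq> B" for A B :: "'a set"
      proof
        fix z assume "z \<in> ideal_span A P"
        then show "z \<in> ideal_span B P"
          by (induction rule: ideal_span.induct) (use that in \<open>auto intro: ideal_span.intros\<close>)
      qed
      have "B \<subseteq> D \<or> D \<subseteq> B" using C XY by (auto simp: subset_chain_def)
      then obtain Z where Z: "Z \<in> C" "B \<subseteq> Z" "D \<subseteq> Z" using XY by auto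
      then have "p * a + z \<in> ideal_span Z P"
        using step(1) XY mono[OF Z(3)] by (intro ideal_span.step) auto
      then show ?case using Z by blast
    qed
    ultimately show "\<Union>C \<in> S" using CS by (auto simp: S_def)
  qed
  then obtain A where A: "A \<in> S" and max: "\<And>B. B \<in> S \<Longrightarrow> A \<subseteq> B \<Longrightarrow> B = A" by blast
  interpret sring A using A by (simp add: S_def)
  have PA: "P \<subseteq> A" and nI: "1 \<notin> ideal_span A P" using A assms by (auto simp: S_def)
  have ext: "\<exists>q\<in>polys (ideal_span A P). poly q x = 1" if "x \<notin> A" for x
  proof -
    have "adjoin x \<notin> S" using max[of "adjoin x"] subset_adjoin mem_adjoin that by auto
    then have "1 \<in> ideal_span (adjoin x) P"
      using A sring_adjoin subset_adjoin[of x] by (auto simp: S_def)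
    then show ?thesis using ideal_span_adjoin by blast
  qed
  have units: "inverse (1 - d) \<in> A" if d: "d \<in> ideal_span A P" for d
  proof (rule ccontr)
    assume "inverse (1 - d) \<notin> A"
    then obtain q where q: "q \<in> polys (ideal_span A P)" "poly q (inverse (1 - d)) = 1"
      using ext by blast
    have n0: "1 - d \<noteq> 0" using d nI by auto
    have dA: "1 - d \<in> A" using d ideal_span_subset[OF PA] diff_mem by auto
    \<comment> \<open>The relation at \<open>1/(1 - d)\<close>, multiplied by a power of
      \<open>1 - d\<close>, puts that power into the ideal, although it is \<open>1\<close> modulo
      the ideal.\<close>
    have "(1 - d) ^ degree q = poly (reflect_poly q) (1 - d)"
      using poly_reflect_poly_nz[OF n0, of q] q by simp
    also have "\<dots> \<in> ideal_span A P"
      using q dA by (intro poly_ideal_span reflect_polys) (auto intro: ideal_span.zero)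
    finally have "(1 - d) ^ degree q + (1 - (1 - d) ^ degree q) \<in> ideal_span A P"
      by (intro ideal_span_add power_one_minus d PA)
    then show False using nI by simp
  qed
  have "valring A"
  proof
    fix x
    show "x \<in> A \<or> inverse x \<in> A"
    proof (rule ccontr)
      assume "\<not> ?thesis"
      then have x: "x \<notin> A" "inverse x \<notin> A" by auto
      then have "x \<noteq> 0" by auto
      with ext[OF x(1)] ext[OF x(2)] mutual_reduction[OF sring_axioms nI PA units]
      show False by blast
    qed
  qed
  moreover have "inverse p \<notin> A" if "p \<in> P" "p \<noteq> 0" for p
  proof
    assume "inverse p \<in> A"
    then have "p * inverse p + 0 \<in> ideal_span A P"
      using that by (intro ideal_span.intros) auto
    then show False using nI that by simp
  qed
  ultimately show thesis using that A by (auto simp: S_def)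
qed

section \<open>Valuation rings and algebraic integers\<close>

context valring
begin

definition M :: "'a set" where "M = {x \<in> V. x = 0 \<or> inverse x \<notin> V}"

definition units :: "'a set" where "units = {x \<in> V. x \<noteq> 0 \<and> inverse x \<in> V}"

lemma M_V: "x \<in> M \<Longrightarrow> x \<in> V" and units_V: "x \<in> units \<Longrightarrow> x \<in> V"
  and units_nz: "x \<in> units \<Longrightarrow> x \<noteq> 0" and units_inverse: "x \<in> units \<Longrightarrow> inverse x \<in> units"
  and V_cases: "x \<in> V \<Longrightarrow> x \<notin> M \<longleftrightarrow> x \<in> units" and zero_M [simp]: "0 \<in> M"
  and one_units [simp]: "1 \<in> units" and not_V: "x \<notin> V \<Longrightarrow> inverse x \<in> M"
  using total[of x] by (auto simp: M_def units_def)

lemma units_not_M: "x \<in> units \<Longrightarrow> x \<notin> M" 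
  by (auto simp: M_def units_def)

lemma one_not_M [simp]: "1 \<notin> M" 
  using units_not_M by auto

lemma units_mult: "x \<in> units \<Longrightarrow> y \<in> units \<Longrightarrow> x * y \<in> units"
  by (auto simp: units_def intro: mult_mem)

lemma units_divide: "x \<in> units \<Longrightarrow> y \<in> units \<Longrightarrow> x / y \<in> units"
  by (simp add: divide_inverse units_mult units_inverse)

lemma units_power: "x \<in> units \<Longrightarrow> x ^ n \<in> units"
  by (induction n) (auto intro: units_mult)

lemma units_powi: "x \<in> units \<Longrightarrow> x powi k \<in> units"
  by (auto simp: power_int_def units_power units_inverse)

lemma M_mult: "x \<in> M \<Longrightarrow> y \<in> V \<Longrightarrow> x * y \<in> M"
proof -
  assume x: "x \<in> M" and y: "y \<in> V"
  have "inverse (x * y) \<notin> V" if "x * y \<noteq> 0"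
  proof
    assume "inverse (x * y) \<in> V"
    then have "inverse (x * y) * y \<in> V" using y mult_mem by blast
    then have "inverse x \<in> V" using that by (simp add: field_simps)
    then show False using x that by (auto simp: M_def)
  qed
  then show ?thesis using x y by (auto simp: M_def intro: mult_mem)
qed

lemma M_mult': "x \<in> V \<Longrightarrow> y \<in> M \<Longrightarrow> x * y \<in> M"
  using M_mult[of y x] by (simp add: mult.commute)

lemma divide_total: "x / y \<in> V \<or> y / x \<in> V"
  using total[of "x / y"] by (simp add: divide_inverse mult.commute)

lemma M_add: "x \<in> M \<Longrightarrow> y \<in> M \<Longrightarrow> x + y \<in> M"
proof -
  assume x: "x \<in> M" and y: "y \<in> M"
  have *: "x + y \<in> M" if "x \<in> M" "x \<noteq> 0" "y / x \<in> V" for x y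
  proof -
    have "x * (1 + y / x) \<in> M" using that by (intro M_mult add_mem) auto
    moreover have "x * (1 + y / x) = x + y" using that by (simp add: field_simps)
    ultimately show ?thesis by simp
  qed
  show ?thesis
  proof (cases "x = 0 \<or> y = 0")
    case False
    then show ?thesis using *[of x y] *[of y x] x y divide_total[of x y] by (auto simp: add.commute)
  qed (use x y in auto)
qed

lemma M_uminus: "x \<in> M \<Longrightarrow> - x \<in> M"
  using M_mult[of x "- 1"] uminus_mem[of 1] by simp

lemma M_diff: "x \<in> M \<Longrightarrow> y \<in> M \<Longrightarrow> x - y \<in> M"
  using M_add[of x "- y"] M_uminus by simp

lemma M_sum: "(\<And>i. i \<in> I \<Longrightarrow> f i \<in> M) \<Longrightarrow> sum f I \<in> M"
  by (induction I rule: infinite_finite_induct) (auto intro: M_add)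

lemma M_prime: "x \<in> V \<Longrightarrow> y \<in> V \<Longrightarrow> x * y \<in> M \<Longrightarrow> x \<in> M \<or> y \<in> M"
  using V_cases units_mult units_not_M by blast

lemma M_power: "x \<in> V \<Longrightarrow> x ^ n \<in> M \<Longrightarrow> x \<in> M"
  by (induction n) (auto dest: M_prime intro: power_mem)

lemma units_add_M: "x \<in> units \<Longrightarrow> y \<in> M \<Longrightarrow> x + y \<in> units"
proof -
  assume x: "x \<in> units" and y: "y \<in> M"
  have "x + y \<notin> M"
  proof
    assume "x + y \<in> M"
    then have "(x + y) - y \<in> M" using y M_diff by blast
    then show False using x units_not_M by simp
  qed
  then show ?thesis using V_cases[of "x + y"] add_mem x y units_V M_V by auto
qed

lemma units_mult_M: "x \<in> V \<Longrightarrow> y \<in> V \<Longrightarrow> x * y \<in> units \<Longrightarrow> x \<in> units"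
  using M_mult[of x y] units_not_M V_cases by blast

lemma units_power_cancel: "n > 0 \<Longrightarrow> x ^ n \<in> units \<Longrightarrow> x \<in> units"
proof -
  assume n: "n > 0" and x: "x ^ n \<in> units"
  have *: "y \<in> V" if "y ^ n \<in> units" for y
  proof (rule ccontr)
    assume "y \<notin> V"
    then have "inverse y * inverse y ^ (n - 1) \<in> M" using not_V M_V power_mem M_mult by blast
    then have "inverse (y ^ n) \<in> M" using n by (cases n) (auto simp: power_inverse mult.commute)
    then show False using that units_inverse units_not_M by blast
  qed
  have "x \<noteq> 0" using x n units_nz by fastforce
  then show ?thesis using *[of x] *[of "inverse x"] x units_inverse[OF x] by (auto simp: units_def power_inverse)
qed

lemma poly_M: "p \<in> polys M \<Longrightarrow> x \<in> V \<Longrightarrow> poly p x \<in> M"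
  by (auto simp: polys_def poly_altdef intro!: M_sum M_mult power_mem)

text \<open>Integral closedness of \<open>V\<close> without making \<open>q\<close> monic. If
  \<open>x\<close> is not in \<open>V\<close>, then \<open>1/x\<close> is, and multiplying
  \<open>q(x) = 0\<close> by the right power of \<open>1/x\<close> leaves
  \<open>lead_coeff q * x\<close> and otherwise only terms in \<open>V\<close>.\<close>

lemma lead_coeff_mult_root:
  assumes q: "q \<in> polys V" "q \<noteq> 0" "poly q x = 0"
  shows "lead_coeff q * x \<in> V"
proof (cases "x \<in> V")
  case True
  then show ?thesis using q polysD mult_mem by blast
next
  case False
  define y where "y = inverse x"
  have y: "y \<in> V" "x \<noteq> 0" using False total[of x] by (auto simp: y_def)
  obtain n where n: "degree q = Suc n"
    using q by (cases "degree q") (auto elim!: degree_eq_zeroE)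
  have "y ^ n * ((\<Sum>i\<le>n. coeff q i * x ^ i) + lead_coeff q * x ^ Suc n) = 0"
    using q(3) by (simp add: poly_altdef n)
  then have "y ^ n * (\<Sum>i\<le>n. coeff q i * x ^ i) + lead_coeff q * (x ^ Suc n * y ^ n) = 0"
    by (simp only: distrib_left mult_ac)
  moreover have "x ^ Suc n * y ^ n = x" using y by (simp add: y_def field_simps)
  moreover have "y ^ n * (\<Sum>i\<le>n. coeff q i * x ^ i) = (\<Sum>i\<le>n. coeff q i * y ^ (n - i))"
    unfolding sum_distrib_left
    by (intro sum.cong) (use y in \<open>auto simp: y_def field_simps power_diff\<close>)
  ultimately have "lead_coeff q * x = - (\<Sum>i\<le>n. coeff q i * y ^ (n - i))"
    by (metis add_eq_0_iff2 add.commute)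
  then show ?thesis
    using q y by (auto intro!: uminus_mem sum_mem mult_mem power_mem polysD)
qed

end

section \<open>Algebraic integers as the intersection of all valuation rings\<close>

lemma algebraic_int_mem_valring:
  fixes V :: "'a::field_char_0 set"
  assumes "valring V" "algebraic_int x"
  shows "x \<in> V"
proof -
  interpret valring V by fact
  from \<open>algebraic_int x\<close>
  obtain p where p: "lead_coeff p = 1" "\<forall>i. coeff p i \<in> \<int>" "poly p x = 0"
    by (auto simp: algebraic_int.simps)
  have "coeff p i \<in> V" for i
    using p(2) of_int_mem by (metis Ints_cases)
  then have "p \<in> polys V" by (simp add: polys_def)
  moreover have "p \<noteq> 0" using p(1) by auto
  ultimately show ?thesis using lead_coeff_mult_root[of p x] p by auto
qed

text \<open>With \<open>y = 1/x\<close>: if \<open>y\<close> generates a proper ideal of Z[y],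
  Chevalley's theorem puts \<open>y\<close> into the maximal ideal of some valuation ring, which
  then omits \<open>x\<close>. Otherwise \<open>1 = y p(y)\<close>, and reversing this relation
  gives a monic equation for \<open>x\<close>.\<close>

lemma algebraic_intI_valring:
  fixes x :: "'a::field_char_0"
  assumes "\<And>V. valring V \<Longrightarrow> x \<in> V"
  shows "algebraic_int x"
proof (cases "x = 0")
  case False
  define y where "y = inverse x"
  interpret Z: sring "\<int> :: 'a set" by standard auto
  show ?thesis
  proof (cases "1 \<in> ideal_span (Z.adjoin y) {y}")
    case False
    have "{y} \<subseteq> Z.adjoin y" using Z.mem_adjoin by simp
    then obtain V where V: "valring V" "inverse y \<notin> V"
      using valring_extension[OF Z.sring_adjoin _ False] \<open>x \<noteq> 0\<close> unfolding y_def
      by (metis insertI1 nonzero_imp_inverse_nonzero)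
    then show ?thesis using assms by (auto simp: y_def)
  next
    case True
    have "\<exists>p\<in>polys \<int>. z = y * poly p y" if "z \<in> ideal_span (Z.adjoin y) {y}" for z
      using that
    proof (induction rule: ideal_span.induct)
      case zero
      then show ?case by (intro bexI[of _ 0]) auto
    next
      case (step p a z)
      then obtain q r where "q \<in> polys \<int>" "a = poly q y" "r \<in> polys \<int>" "z = y * poly r y"
        by (auto simp: Z.adjoin_def)
      then show ?case using step(1) Z.polys_add by (intro bexI[of _ "q + r"]) (auto simp: algebra_simps)
    qed
    then obtain p where p: "p \<in> polys \<int>" "1 = y * poly p y" using True by blast
    have "algebraic_int (inverse y)"
    proof (rule algebraic_int_inverse)
      show "poly (1 - pCons 0 p) y = 0" using p by simp
      have "1 - pCons 0 p \<in> polys \<int>" using p Z.polys_diff Z.polys_pCons by simp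
      then show "\<forall>i. coeff (1 - pCons 0 p) i \<in> \<int>" by (simp add: polys_def)
    qed simp
    then show ?thesis by (simp add: y_def)
  qed
qed auto

lemma algebraic_int_add: "algebraic_int x \<Longrightarrow> algebraic_int y \<Longrightarrow> algebraic_int (x + y :: 'a::field_char_0)"
  using algebraic_int_mem_valring sring.add_mem valring.axioms(1) algebraic_intI_valring by metis

lemma algebraic_int_mult: "algebraic_int x \<Longrightarrow> algebraic_int y \<Longrightarrow> algebraic_int (x * y :: 'a::field_char_0)"
  using algebraic_int_mem_valring sring.mult_mem valring.axioms(1) algebraic_intI_valring by metis

lemma algebraic_int_lead_coeff_mult_root:
  fixes x :: "'a::field_char_0"
  assumes "q \<in> polys {x. algebraic_int x}" "q \<noteq> 0" "poly q x = 0"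
  shows "algebraic_int (lead_coeff q * x)"
proof (rule algebraic_intI_valring)
  fix V :: "'a set"
  assume "valring V"
  then interpret valring V .
  have "{x. algebraic_int x} \<subseteq> V"
    using algebraic_int_mem_valring[OF \<open>valring V\<close>] by blast
  then show "lead_coeff q * x \<in> V" using lead_coeff_mult_root polys_mono assms by blast
qed

locale sfield = sring K for K :: "'a::field set" +
  assumes inverse_mem: "x \<in> K \<Longrightarrow> inverse x \<in> K"
begin

lemma divide_mem: "x \<in> K \<Longrightarrow> y \<in> K \<Longrightarrow> x / y \<in> K"
  by (simp add: divide_inverse mult_mem inverse_mem)

lemma powi_mem: "x \<in> K \<Longrightarrow> x powi k \<in> K"
  by (auto simp: power_int_def power_mem inverse_mem)

end

locale cvalring = valring V for V :: "complex set" +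
  fixes p :: nat
  assumes prime_p: "prime p" and p_M: "of_nat p \<in> M"
begin

lemma of_int_M: "of_int n \<in> M \<longleftrightarrow> int p dvd n"
proof
  assume "int p dvd n"
  then obtain m where "n = int p * m" by auto
  then show "of_int n \<in> M" using M_mult[OF p_M, of "of_int m"] by simp
next
  assume n: "of_int n \<in> M"
  show "int p dvd n"
  proof (rule ccontr)
    assume "\<not> int p dvd n"
    have "prime (int p)" using prime_p by simp
    then have "gcd (int p) n = 1"
      using \<open>\<not> int p dvd n\<close> prime_imp_coprime coprime_iff_gcd_eq_1 by blast
    then obtain u v where "u * int p + v * n = 1"
      using bezout_int[of "int p" n] by metis
    then have "of_int (u * int p + v * n) = (1::complex)" by simp
    moreover have "of_int u * of_nat p + of_int v * of_int n \<in> M"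
      using n p_M by (intro M_add M_mult') auto
    ultimately show False by simp
  qed
qed

lemma p_nz [simp]: "p \<noteq> 0" "p \<noteq> Suc 0" using prime_p by (auto intro: Nat.gr0I)

lemma of_int_decomp:
  assumes "n \<noteq> 0"
  obtains k where "of_int n / of_nat p ^ k \<in> units"
proof -
  obtain m where m: "n = int p ^ multiplicity (int p) n * m" "\<not> int p dvd m"
    using multiplicity_decompose'[of n "int p"] assms prime_p by (auto simp: prime_nat_iff)
  then have "of_int m \<in> units" using of_int_M[of m] V_cases[of "of_int m"] by auto
  moreover have "of_int n / of_nat p ^ multiplicity (int p) n = (of_int m :: complex)"
    by (subst m(1)) simp
  ultimately show ?thesis using that by metis
qed

text \<open>\<open>z\<close> divides the constant coefficient of an integer polynomial with root
  \<open>z\<close>, and in \<open>V\<close> that integer is a unit times a power of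
  \<open>p\<close>. This bounds the number of steps in the descent of
  \<open>etale_value\<close>.\<close>

lemma algebraic_dvd_p_power:
  assumes "algebraic z" "z \<noteq> 0" "z \<in> V"
  obtains k where "of_nat p ^ k / z \<in> V"
proof -
  obtain q where q: "coeff q 0 \<noteq> 0" "poly (map_poly of_int q) z = 0"
    using algebraicE'_nonzero[OF assms(1,2)] by auto
  obtain a r where r: "q = pCons a r" by (cases q) auto
  have e: "of_int a = - z * poly (map_poly of_int r) z"
    using q(2) by (simp add: r map_poly_pCons add_eq_0_iff2)
  have nz: "(of_int a :: complex) \<noteq> 0" using q(1) r by simp
  have rV: "poly (map_poly of_int r) z \<in> V"
    using assms(3) by (intro poly_mem) (auto simp: polys_def coeff_map_poly)
  obtain k where k: "of_int a / of_nat p ^ k \<in> units" using of_int_decomp[of a] q(1) r by auto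
  have "of_nat p ^ k / z = inverse (of_int a / of_nat p ^ k) * (- poly (map_poly of_int r) z)"
    using nz assms(2) unfolding e by (simp add: field_simps)
  moreover have "inverse (of_int a / of_nat p ^ k) \<in> V" using k units_inverse units_V by blast
  ultimately have "of_nat p ^ k / z \<in> V" using rV mult_mem uminus_mem by metis
  then show ?thesis by (rule that)
qed

end

text \<open>The constant coefficient of an integer polynomial with root \<open>b\<close> is a
  multiple of \<open>b\<close>, so \<open>M\<close> contains a nonzero integer; \<open>M\<close>
  being prime, it contains a prime factor of it.\<close>

lemma exists_prime_M:
  fixes b :: "'a :: field_char_0"
  assumes "valring V" "algebraic b" "b \<noteq> 0" "b \<in> valring.M V"
  shows "\<exists>p::nat. prime p \<and> of_nat p \<in> valring.M V"
proof -
  interpret valring V by fact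
  obtain q where q: "coeff q 0 \<noteq> 0" "poly (map_poly of_int q) b = 0"
    using algebraicE'_nonzero[OF assms(2,3)] by auto
  obtain a r where r: "q = pCons a r" by (cases q) auto
  have e: "of_int a = - b * poly (map_poly of_int r) b"
    using q(2) by (simp add: r map_poly_pCons add_eq_0_iff2)
  have "poly (map_poly of_int r) b \<in> V"
    using assms(4) M_V by (intro poly_mem) (auto simp: polys_def coeff_map_poly)
  then have "of_int a \<in> M" unfolding e using assms M_mult M_uminus by auto
  then have "of_nat (nat \<bar>a\<bar>) \<in> M" using M_uminus[of "of_int a"] by (cases "a \<ge> 0") auto
  moreover have "nat \<bar>a\<bar> \<noteq> 0" using q(1) r by auto
  ultimately have "\<exists>n. n \<noteq> 0 \<and> of_nat n \<in> M" by blast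
  then obtain n where "n \<noteq> 0" "of_nat n \<in> M" by blast
  then show ?thesis
  proof (induction n rule: less_induct)
    case (less n)
    then have "n \<noteq> 1" by auto
    then obtain p where p: "prime p" "p dvd n" using prime_factor_nat by blast
    then obtain m where m: "n = p * m" by auto
    then have "of_nat p \<in> M \<or> of_nat m \<in> M" using M_prime[of "of_nat p" "of_nat m"] less by auto
    moreover have "m < n" "m \<noteq> 0" using m less p prime_gt_1_nat[of p] by auto
    ultimately show ?case using p less by blast
  qed
qed

section \<open>Uniformisers of number fields\<close>

lemma algebraic_iff_algebraic_int:
  "algebraic (x :: 'a::field_char_0) \<longleftrightarrow> (\<exists>n::int. n \<noteq> 0 \<and> algebraic_int (of_int n * x))"
proof
  assume "algebraic x"
  then obtain q where q: "q \<noteq> 0" "poly (map_poly of_int q) x = 0"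
    by (elim algebraicE')
  have "algebraic_int (lead_coeff (map_poly of_int q) * x)"
  proof (rule algebraic_int_lead_coeff_mult_root)
    show "map_poly of_int q \<noteq> (0 :: 'a poly)"
      using q(1) by (subst map_poly_eq_0_iff) auto
  qed (use q in \<open>auto simp: polys_def coeff_map_poly\<close>)
  then show "\<exists>n::int. n \<noteq> 0 \<and> algebraic_int (of_int n * x)"
    using q(1) by (intro exI[of _ "lead_coeff q"]) (auto simp: coeff_map_poly degree_map_poly)
next
  assume "\<exists>n::int. n \<noteq> 0 \<and> algebraic_int (of_int n * x)"
  then obtain n :: int and q where n: "n \<noteq> 0" and
    q: "lead_coeff q = 1" "\<forall>i. coeff q i \<in> \<int>" "poly q (of_int n * x) = 0"
    by (auto simp: algebraic_int.simps)
  show "algebraic x"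
  proof (rule algebraicI[of "pcompose q [:0, of_int n:]"])
    show "coeff (pcompose q [:0, of_int n:]) i \<in> \<int>" for i
      using q by (intro coeff_pcompose_semiring_closed) (auto simp: coeff_pCons split: nat.splits)
    have "q \<noteq> 0" using q(1) by auto
    then show "pcompose q [:0, of_int n:] \<noteq> 0" using n by (subst pcompose_eq_0_iff) auto
    show "poly (pcompose q [:0, of_int n:]) x = 0"
      using q by (simp add: poly_pcompose mult.commute)
  qed
qed

lemma sfield_algebraic: "sfield {x :: 'a::field_char_0. algebraic x}"
proof
  show "1 \<in> {x :: 'a. algebraic x}" by auto
next
  fix x y :: 'a
  assume "x \<in> {x. algebraic x}" "y \<in> {x. algebraic x}"
  then obtain n m :: int where nm: "n \<noteq> 0" "algebraic_int (of_int n * x)"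
      "m \<noteq> 0" "algebraic_int (of_int m * y)"
    by (auto simp: algebraic_iff_algebraic_int)
  have "algebraic_int (of_int m * (of_int n * x) + of_int (- n) * (of_int m * y))"
    by (intro algebraic_int_add algebraic_int_mult nm) auto
  also have "of_int m * (of_int n * x) + of_int (- n) * (of_int m * y) = of_int (n * m) * (x - y)"
    by (simp add: algebra_simps)
  finally show "x - y \<in> {x. algebraic x}"
    using nm by (auto simp: algebraic_iff_algebraic_int intro!: exI[of _ "n * m"])
  have "algebraic_int ((of_int n * x) * (of_int m * y))"
    by (intro algebraic_int_mult nm)
  also have "(of_int n * x) * (of_int m * y) = of_int (n * m) * (x * y)"
    by (simp add: algebra_simps)
  finally show "x * y \<in> {x. algebraic x}"
    using nm by (auto simp: algebraic_iff_algebraic_int intro!: exI[of _ "n * m"])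
qed auto


context valring
begin

lemma units_powi_M:
  assumes "c \<in> M" "c \<noteq> 0"
  shows "c powi k \<in> V \<longleftrightarrow> k \<ge> 0" "c powi k \<in> M \<longleftrightarrow> k > 0" "c powi k \<in> units \<longleftrightarrow> k = 0"
proof -
  have pos: "c powi k \<in> M" if "k > 0" for k
    using that
  proof -
    assume "k > 0"
    from zero_less_imp_eq_int[OF this] obtain n where n: "n > 0" "k = int n" by blast
    have "c * c ^ (n - 1) \<in> M" using M_mult[OF assms(1) power_mem[OF M_V[OF assms(1)]]] .
    then show ?thesis using n by (simp flip: power_Suc)
  qed
  have neg: "c powi k \<notin> V" if "k < 0" for k
    using pos[of "- k"] that assms by (auto simp: power_int_minus M_def)
  consider "k > 0" | "k = 0" | "k < 0" by linarith
  then have "(c powi k \<in> V \<longleftrightarrow> k \<ge> 0) \<and> (c powi k \<in> M \<longleftrightarrow> k > 0) \<and> (c powi k \<in> units \<longleftrightarrow> k = 0)"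
  proof cases
    case 1
    then show ?thesis using pos[of k] M_V units_not_M by auto
  next
    case 3
    then show ?thesis using neg[of k] M_V units_V by auto
  qed auto
  then show "c powi k \<in> V \<longleftrightarrow> k \<ge> 0" "c powi k \<in> M \<longleftrightarrow> k > 0" "c powi k \<in> units \<longleftrightarrow> k = 0"
    by auto
qed

lemma units_add_cases:
  assumes "a \<noteq> 0" "b \<noteq> 0" "a / b \<notin> units"
  shows "(a + b) / a \<in> units \<or> (a + b) / b \<in> units"
proof (cases "a / b \<in> V")
  case True
  then have "1 + a / b \<in> units" using True assms V_cases[of "a / b"] units_add_M[OF one_units, of "a / b"] by blast
  then show ?thesis using assms by (simp add: add_divide_distrib add.commute)
next
  case False
  then have "inverse (a / b) \<in> M" using not_V by blast
  then have "1 + inverse (a / b) \<in> units" using units_add_M[OF one_units] by blast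
  then show ?thesis using assms by (simp add: add_divide_distrib)
qed

text \<open>Ultrametric principle: the term of least value dominates. In particular a vanishing sum
  of nonzero terms has two terms of equal value.\<close>

lemma sum_distinct_values:
  assumes "finite I" "I \<noteq> {}" "\<And>i. i \<in> I \<Longrightarrow> t i \<noteq> 0"
    "\<And>i j. i \<in> I \<Longrightarrow> j \<in> I \<Longrightarrow> i \<noteq> j \<Longrightarrow> t i / t j \<notin> units"
  shows "\<exists>i\<in>I. sum t I / t i \<in> units"
  using assms
proof (induction I rule: finite_ne_induct)
  case (insert n I)
  then obtain i where i: "i \<in> I" "sum t I / t i \<in> units" by auto
  have nz: "t n \<noteq> 0" "t i \<noteq> 0" "sum t I \<noteq> 0" using units_nz[OF i(2)] insert.prems i by auto
  have ne: "t n / sum t I \<notin> units"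
  proof
    assume "t n / sum t I \<in> units"
    then have "(t n / sum t I) * (sum t I / t i) \<in> units" using i units_mult by blast
    then have "t n / t i \<in> units" using nz by simp
    moreover have "n \<noteq> i" using insert i by auto
    ultimately show False using insert.prems i by blast
  qed
  from units_add_cases[OF nz(1,3) ne] show ?case
  proof
    assume "(t n + sum t I) / sum t I \<in> units"
    then have "((t n + sum t I) / sum t I) * (sum t I / t i) \<in> units" using i units_mult by blast
    then show ?thesis using nz insert i by auto
  qed (use insert in auto)
qed auto

text \<open>The valuation restricted to \<open>K\<close> is discrete with generator
  \<open>c\<close>. Keeping \<open>c\<close> fixed while \<open>K\<close> grows expresses that the
  larger field has ramification index 1 over the smaller one.\<close>

definition uniformizer :: "'a \<Rightarrow> 'a set \<Rightarrow> bool" where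
  "uniformizer c K \<longleftrightarrow> c \<in> K \<and> c \<in> M \<and> c \<noteq> 0 \<and> (\<forall>x\<in>K. x \<noteq> 0 \<longrightarrow> (\<exists>k::int. x / c powi k \<in> units))"

end

context cvalring
begin

text \<open>In \<open>q(y) = 0\<close> two terms, of indices \<open>i < j\<close> say, must have
  equal value, so \<open>y^(j-i)\<close> has the value of a power of \<open>p\<close>. As
  \<open>1 <= j - i <= n\<close>, the exponent \<open>fact n\<close> serves all \<open>y\<close> of
  degree at most \<open>n\<close> at once.\<close>

lemma power_fact_value:
  assumes "y \<noteq> 0" "q \<noteq> 0" "poly (map_poly of_int q) y = 0" "degree q \<le> n"
  shows "\<exists>k::int. y ^ fact n / of_nat p powi k \<in> units"
proof -
  define t where "t = (\<lambda>i. of_int (coeff q i) * y ^ i)"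
  define I where "I = {i. coeff q i \<noteq> 0}"
  have fin: "finite I" "I \<subseteq> {..degree q}" using MOST_coeff_eq_0[of q] le_degree
    by (auto simp: I_def eventually_cofinite)
  have "sum t I = (\<Sum>i\<le>degree q. t i)"
    by (rule sum.mono_neutral_left) (use fin in \<open>auto simp: I_def t_def\<close>)
  also have "\<dots> = 0"
    using assms(3) by (simp add: poly_altdef t_def degree_map_poly coeff_map_poly)
  finally have "sum t I = 0" .
  moreover have "I \<noteq> {}" using assms(2) by (auto simp: I_def poly_eq_iff)
  moreover have "t i \<noteq> 0" if "i \<in> I" for i using that assms(1) by (auto simp: I_def t_def)
  ultimately have "\<exists>i\<in>I. \<exists>j\<in>I. i \<noteq> j \<and> t i / t j \<in> units"
    using sum_distinct_values[OF fin(1), of t] units_nz[of 0] by auto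
  then obtain i j where ij: "i \<in> I" "j \<in> I" "i \<noteq> j" "t i / t j \<in> units" by blast
  have main: ?thesis if ij: "i \<in> I" "j \<in> I" "i < j" "t j / t i \<in> units" for i j
  proof -
    have ci: "coeff q i \<noteq> 0" and cj: "coeff q j \<noteq> 0" using ij by (auto simp: I_def)
    obtain a where a: "of_int (coeff q j) / of_nat p ^ a \<in> units" using of_int_decomp[OF cj] .
    obtain b where b: "of_int (coeff q i) / of_nat p ^ b \<in> units" using of_int_decomp[OF ci] .
    define d where "d = j - i"
    have d: "0 < d" "d \<le> n" using ij fin(2) assms(4) by (auto simp: d_def)
    have jd: "j = i + d" using ij by (simp add: d_def)
    have nz: "of_int (coeff q i) \<noteq> (0::complex)" "of_int (coeff q j) \<noteq> (0::complex)"
      using ij by (auto simp: I_def)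
    have "(t j / t i) * ((of_int (coeff q i) / of_nat p ^ b) / (of_int (coeff q j) / of_nat p ^ a)) \<in> units"
      by (intro units_mult units_divide ij a b)
    also have "(t j / t i) * ((of_int (coeff q i) / of_nat p ^ b) / (of_int (coeff q j) / of_nat p ^ a))
       = y ^ d / of_nat p powi (int b - int a)"
    proof -
      have "of_nat p powi (int b - int a) = of_nat p ^ b / (of_nat p ^ a :: complex)"
        by (subst power_int_diff) auto
      moreover have "t j / t i = of_int (coeff q j) / of_int (coeff q i) * y ^ d"
        using assms(1) unfolding t_def by (subst (2) jd) (simp add: power_add)
      ultimately show ?thesis using nz by simp
    qed
    finally have u: "y ^ d / of_nat p powi (int b - int a) \<in> units" .
    have "d dvd fact n" using d by (intro dvd_fact) auto
    then obtain e where e: "fact n = d * e" by auto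
    have "(y ^ d / of_nat p powi (int b - int a)) ^ e \<in> units" using u units_power by blast
    also have "(y ^ d / of_nat p powi (int b - int a)) ^ e = y ^ fact n / of_nat p powi ((int b - int a) * int e)"
      unfolding e power_mult power_divide power_int_mult power_int_of_nat ..
    finally show ?thesis by blast
  qed
  show ?thesis
  proof (cases "i < j")
    case True
    then show ?thesis using main[of i j] ij units_inverse[OF ij(4)] by simp
  next
    case False
    then show ?thesis using main[of j i] ij by simp
  qed
qed

lemma exists_uniformizer:
  assumes "sfield K"
    and bdd: "\<And>y. y \<in> K \<Longrightarrow> \<exists>q. q \<noteq> 0 \<and> degree q \<le> n \<and> poly (map_poly of_int q) y = 0"
  shows "\<exists>c. uniformizer c K"
proof -
  interpret K: sfield K by fact
  define N :: nat where "N = fact n"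
  have N: "N > 0" by (simp add: N_def)
  have pm: "of_nat p \<in> M" "(of_nat p :: complex) \<noteq> 0" using p_M by auto
  have val: "\<exists>k::int. y ^ N / of_nat p powi k \<in> units" if "y \<in> K" "y \<noteq> 0" for y
    using bdd[OF that(1)] power_fact_value that(2) unfolding N_def by blast
  \<comment> \<open>\<open>j\<close> in \<open>D\<close> means that \<open>j/N\<close> times the
    value of \<open>p\<close> is a positive value taken on \<open>K\<close>; \<open>N\<close> itself
    comes from \<open>y = p\<close>, and the least \<open>j\<close> will belong to a
    uniformiser.\<close>
  define D where "D = {j::nat. j > 0 \<and> (\<exists>y\<in>K. y \<noteq> 0 \<and> y \<in> M \<and> y ^ N / of_nat p ^ j \<in> units)}"
  have "N \<in> D" unfolding D_def mem_Collect_eq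
    by (intro conjI N bexI[of _ "of_nat p"]) (use pm in auto)
  define j where "j = (LEAST j. j \<in> D)"
  have "j \<in> D" unfolding j_def using \<open>N \<in> D\<close> by (rule LeastI)
  then obtain c where c: "j > 0" "c \<in> K" "c \<noteq> 0" "c \<in> M" "c ^ N / of_nat p ^ j \<in> units"
    by (auto simp: D_def)
  have least: "j \<le> i" if "i \<in> D" for i unfolding j_def using that by (rule Least_le)
  have "\<exists>k::int. x / c powi k \<in> units" if x: "x \<in> K" "x \<noteq> 0" for x
  proof -
    obtain k where k: "x ^ N / of_nat p powi k \<in> units" using val x by blast
    \<comment> \<open>Division with remainder: \<open>z = x / c^q\<close> has exponent
      \<open>r < j\<close>, and minimality of \<open>j\<close> leaves only
      \<open>r = 0\<close>.\<close>
    define q r where "q = k div int j" and "r = k mod int j"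
    have kqr: "k = int j * q + r" by (simp add: q_def r_def)
    have r: "0 \<le> r" "r < int j" using c by (auto simp: r_def)
    define z where "z = x / c powi q"
    have zK: "z \<in> K" "z \<noteq> 0" using x c by (auto simp: z_def intro!: K.divide_mem K.powi_mem)
    have "(x ^ N / of_nat p powi k) / ((c ^ N / of_nat p ^ j) powi q) \<in> units"
      using k c units_divide units_powi by blast
    also have "(x ^ N / of_nat p powi k) / ((c ^ N / of_nat p ^ j) powi q) = z ^ N / of_nat p powi r"
    proof -
      have "(of_nat p ^ j) powi q = (of_nat p powi (int j * q) :: complex)" by (simp add: power_int_mult)
      moreover have "(c ^ N) powi q = (c powi q) ^ N" by (simp add: power_int_power power_int_power' mult.commute)
      ultimately show ?thesis using pm(2) c(3)
        by (simp add: kqr z_def power_int_add power_int_divide_distrib power_divide field_simps)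
    qed
    finally have u: "z ^ N / of_nat p powi r \<in> units" .
    show ?thesis
    proof (cases "r = 0")
      case True
      then have "z \<in> units" using u units_power_cancel[OF N] by simp
      then show ?thesis unfolding z_def by blast
    next
      case False
      then have "of_nat p powi r \<in> M" using r units_powi_M[OF pm, of r] by simp
      then have "of_nat p powi r * (z ^ N / of_nat p powi r) \<in> M" using u units_V M_mult by blast
      then have zM: "z ^ N \<in> M" using pm by simp
      have "z \<in> V"
      proof (rule ccontr)
        assume "z \<notin> V"
        then have "inverse z ^ N \<in> V" using not_V M_V power_mem by blast
        then have "z ^ N * inverse z ^ N \<in> M" using zM M_mult by blast
        then show False using zK by (simp flip: power_mult_distrib)
      qed
      then have "z \<in> M" using zM M_power by blast
      then have "nat r \<in> D" using u zK r False by (auto simp: D_def power_int_def)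
      then show ?thesis using least[of "nat r"] r by simp
    qed
  qed
  then show ?thesis using c by (auto simp: uniformizer_def)
qed

text \<open>If the leading coefficient \<open>a\<close> is outside \<open>M\<close>, take
  \<open>s = a\<close>. Otherwise \<open>a T^d\<close> is replaced by \<open>(a y) T^(d-1)\<close>:
  the value at \<open>y\<close> is unchanged, \<open>a y\<close> is integral, and it lies in
  \<open>M\<close>, so a coefficient outside \<open>M\<close> survives while the degree
  drops.\<close>

lemma integral_denominator_aux:
  assumes K: "sfield K" "y \<in> K" "y \<in> V"
    and "q \<in> polys {x \<in> K. algebraic_int x}" "poly q y = 0" "coeff q i \<notin> M"
  shows "\<exists>s\<in>K. algebraic_int s \<and> s \<notin> M \<and> algebraic_int (s * y)"
  using assms(4-)
proof (induction "degree q" arbitrary: q rule: less_induct)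
  case less
  interpret K: sfield K by fact
  have qK: "coeff q i \<in> K" "algebraic_int (coeff q i)" for i using less.prems by (auto simp: polys_def)
  have q0: "q \<noteq> 0" using less.prems by auto
  have qm: "q \<in> polys {x. algebraic_int x}" using less.prems by (auto simp: polys_def)
  have ay: "algebraic_int (lead_coeff q * y)"
    using algebraic_int_lead_coeff_mult_root[OF qm q0 less.prems(2)] .
  show ?case
  proof (cases "lead_coeff q \<in> M")
    case False
    then show ?thesis using ay qK by blast
  next
    case True
    define d where "d = degree q"
    define a where "a = lead_coeff q"
    have "d \<noteq> 0"
    proof
      assume "d = 0"
      then obtain b where "q = [:b:]" by (auto simp: d_def elim: degree_eq_zeroE)
      then show False using less.prems q0 by auto
    qed
    then obtain e where e: "d = Suc e" by (cases d) auto
    define r where "r = q - monom a d + monom (a * y) e"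
    have "coeff r d = 0" by (simp add: r_def a_def d_def[symmetric] e)
    moreover have "degree r \<le> d" unfolding r_def
      by (intro degree_add_le degree_diff_le order.trans[OF degree_monom_le]) (auto simp: d_def[symmetric] e)
    ultimately have dr: "degree r < degree q"
      unfolding d_def[symmetric] using e by (metis eq_zero_or_degree_less degree_0 zero_less_Suc)
    have "coeff r i \<in> K \<and> algebraic_int (coeff r i)" for i
    proof (cases "i = d")
      case True
      then show ?thesis using \<open>coeff r d = 0\<close> by simp
    next
      case False
      then have "coeff r i = coeff q i + (if i = e then a * y else 0)" by (auto simp: r_def)
      then show ?thesis using qK ay K(2)
        by (auto simp: a_def intro!: K.add_mem K.mult_mem algebraic_int_add)
    qed
    then have 1: "r \<in> polys {x \<in> K. algebraic_int x}" by (simp add: polys_def)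
    have 2: "poly r y = 0" using less.prems by (simp add: r_def poly_monom e)
    have "i \<noteq> d" using True less.prems by (auto simp: d_def)
    then have "coeff r i = coeff q i + (if i = e then a * y else 0)" by (auto simp: r_def)
    then have "coeff r i - (if i = e then a * y else 0) = coeff q i" by simp
    moreover have "a * y \<in> M" using True K(3) M_mult by (simp add: a_def)
    ultimately have 3: "coeff r i \<notin> M" using less.prems(3) M_diff by (metis zero_M)
    show ?thesis using less.hyps[OF dr 1 2 3] .
  qed
qed

text \<open>A primitive integer polynomial with root \<open>y\<close> has a coefficient not
  divisible by \<open>p\<close>, which starts the reduction of
  \<open>integral_denominator_aux\<close>.\<close>

lemma integral_denominator:
  assumes K: "sfield K" "y \<in> K" "y \<in> V" "algebraic y"
  shows "\<exists>s\<in>K. algebraic_int s \<and> s \<notin> M \<and> algebraic_int (s * y)"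
proof -
  interpret K: sfield K by fact
  obtain q where q: "q \<noteq> 0" "poly (map_poly of_int q) y = 0" using algebraicE'[OF K(4)] by auto
  define r where "r = primitive_part q"
  have "coeff q i = content q * coeff r i" for i
    by (metis content_times_primitive_part coeff_smult r_def)
  then have "map_poly of_int q = smult (of_int (content q)) (map_poly of_int r :: complex poly)"
    by (intro poly_eqI) (simp add: coeff_map_poly)
  then have r0: "poly (map_poly of_int r) y = 0" using q by auto
  have "content r = 1" using q(1) by (simp add: r_def)
  then have "\<not> int p dvd content r" using p_nz by auto
  then obtain i where "\<not> int p dvd coeff r i"
    using const_poly_dvd_iff[of "int p" r] const_poly_dvd_iff_dvd_content[of "int p" r] by auto
  then have "coeff (map_poly of_int r) i \<notin> M" by (simp add: coeff_map_poly of_int_M)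
  then show ?thesis
    using integral_denominator_aux[OF K(1-3) _ r0] by (auto simp: polys_def coeff_map_poly)
qed

text \<open>Multiplying by an integral denominator outside \<open>M\<close> changes \<open>c\<close>
  by a unit only. Integrality is what later puts \<open>c\<close> into the ideal \<open>B\<close>
  and not just into \<open>M\<close>.\<close>

lemma exists_integral_uniformizer:
  assumes "sfield K"
    and bdd: "\<And>y. y \<in> K \<Longrightarrow> \<exists>q. q \<noteq> 0 \<and> degree q \<le> n \<and> poly (map_poly of_int q) y = 0"
  shows "\<exists>c. uniformizer c K \<and> algebraic_int c"
proof -
  interpret K: sfield K by fact
  obtain c where c: "uniformizer c K" using exists_uniformizer assms by blast
  obtain q where "q \<noteq> 0" "poly (map_poly of_int q) c = 0" using bdd[of c] c by (auto simp: uniformizer_def)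
  then have "algebraic c"
    by (intro algebraicI[of "map_poly of_int q"]) (auto simp: coeff_map_poly map_poly_eq_0_iff)
  then obtain s where s: "s \<in> K" "algebraic_int s" "s \<notin> M" "algebraic_int (s * c)"
    using integral_denominator[OF assms(1), of c] c M_V by (auto simp: uniformizer_def)
  have sU: "s \<in> units" using s V_cases algebraic_int_mem_valring[OF valring_axioms] by blast
  have "uniformizer (s * c) K"
    unfolding uniformizer_def
  proof (intro conjI ballI impI)
    show "s * c \<in> K" "s * c \<in> M" "s * c \<noteq> 0"
      using s c sU units_V units_nz by (auto simp: uniformizer_def intro!: K.mult_mem M_mult')
    fix x assume "x \<in> K" "x \<noteq> 0"
    then obtain k :: int where "x / c powi k \<in> units" using c by (auto simp: uniformizer_def)
    then have "(x / c powi k) / s powi k \<in> units" using sU units_divide units_powi by blast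
    then show "\<exists>k::int. x / (s * c) powi k \<in> units"
      by (intro exI[of _ k]) (simp add: power_int_mult_distrib mult.commute)
  qed
  then show ?thesis using s by blast
qed

end

section \<open>Roots that are simple modulo the maximal ideal\<close>

lemma (in sring) monic_division:
  assumes g: "g \<in> polys A" "lead_coeff g = 1" "degree g > 0" and "f \<in> polys A"
  shows "\<exists>q\<in>polys A. \<exists>r\<in>polys A. f = g * q + r \<and> degree r < degree g"
  using assms(4)
proof (induction "degree f" arbitrary: f rule: less_induct)
  case less
  show ?case
  proof (cases "degree f < degree g")
    case True
    then show ?thesis using less by (intro bexI[of _ 0] bexI[of _ f]) auto
  next
    case False
    define d where "d = degree f - degree g"
    define a where "a = lead_coeff f"
    define f1 where "f1 = f - monom a d * g"
    have a: "a \<in> A" using less by (auto simp: a_def polys_def)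
    have dm: "degree (monom a d * g) \<le> degree f"
      by (rule order.trans[OF degree_mult_le]) (use degree_monom_le[of a d] False in \<open>simp add: d_def\<close>)
    have "coeff (monom a d * g) (d + degree g) = a"
      using g(2) by (simp add: coeff_monom_mult)
    then have "coeff f1 (degree f) = 0" using False by (simp add: f1_def a_def d_def)
    moreover have "degree f1 \<le> degree f" unfolding f1_def by (intro degree_diff_le dm) auto
    ultimately have "degree f1 < degree f" using False g(3)
      by (metis eq_zero_or_degree_less degree_0 not_less less_le_trans)
    moreover have m: "monom a d \<in> polys A" using a by (intro monom_polys) auto
    then have "f1 \<in> polys A" unfolding f1_def using less g by (intro polys_diff polys_mult)
    ultimately obtain q r where qr: "q \<in> polys A" "r \<in> polys A" "f1 = g * q + r" "degree r < degree g"
      using less.hyps by blast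
    have "f = g * (q + monom a d) + r" using qr by (simp add: f1_def algebra_simps)
    then show ?thesis using qr m polys_add by blast
  qed
qed

context valring
begin

lemma uniformizer_divide:
  assumes "sfield U" "uniformizer c U" "r \<in> U" "r \<in> M"
  shows "r / c \<in> U \<inter> V"
proof (cases "r = 0")
  case False
  interpret U: sfield U by fact
  have c: "c \<in> U" "c \<in> M" "c \<noteq> 0" using assms by (auto simp: uniformizer_def)
  obtain k where k: "r / c powi k \<in> units" using assms False by (auto simp: uniformizer_def)
  have "r * inverse (r / c powi k) \<in> M" using assms units_inverse[OF k] units_V M_mult by blast
  then have "k > 0" using False units_powi_M[OF c(2,3)] by simp
  then have "c powi (k - 1) \<in> V" using units_powi_M[OF c(2,3)] by simp
  then have "(r / c powi k) * c powi (k - 1) \<in> V" using k units_V mult_mem by blast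
  also have "(r / c powi k) * c powi (k - 1) = r / c" using c by (simp add: power_int_diff)
  finally show ?thesis using c assms U.divide_mem by blast
qed (use assms sring.zero_mem sfield.axioms in auto)

end

context cvalring
begin

text \<open>Adjoining \<open>x\<close> causes no ramification. If \<open>g\<close> is a monic lift
  of the minimal polynomial of \<open>x\<close> modulo \<open>M\<close>, simplicity of the root
  makes \<open>g(x)\<close> a multiple of \<open>c\<close> in R[x], up to a unit
  \<open>q(x)\<close>. Hence every \<open>s(x)\<close> in \<open>M\<close> can be divided by
  \<open>c\<close>, and this stops after finitely many steps.\<close>

lemma etale_value:
  assumes U: "sfield U" "uniformizer c U" "U \<subseteq> {x. algebraic x}"
    and x: "x \<in> V" "algebraic x"
    and h: "h \<in> polys (U \<inter> V)" "lead_coeff h = 1" "poly h x = 0" "poly (pderiv h) x \<notin> M"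
    and s: "s \<in> polys U" "poly s x \<noteq> 0"
  shows "\<exists>k::int. poly s x / c powi k \<in> units"
proof -
  interpret U: sfield U by fact
  define R where "R = U \<inter> V"
  interpret R: sring R
    by standard (auto simp: R_def intro: diff_mem mult_mem U.diff_mem U.mult_mem)
  have c: "c \<in> U" "c \<in> M" "c \<noteq> 0" "c \<in> R" using U M_V by (auto simp: uniformizer_def R_def)
  have RV: "polys R \<subseteq> polys V" by (rule polys_mono) (auto simp: R_def)
  have evV: "poly r x \<in> V" if "r \<in> polys R" for r using that RV x poly_mem by blast
  \<comment> \<open>Least degree plays the role of irreducibility modulo \<open>M\<close>;
    \<open>h\<close> shows that such polynomials exist.\<close>
  obtain g where g: "g \<in> polys R" "lead_coeff g = 1" "poly g x \<in> M"
    and gmin: "\<And>g'. g' \<in> polys R \<Longrightarrow> lead_coeff g' = 1 \<Longrightarrow> poly g' x \<in> M \<Longrightarrow> degree g \<le> degree g'"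
    using ex_has_least_nat[of "\<lambda>g. g \<in> polys R \<and> lead_coeff g = 1 \<and> poly g x \<in> M" h degree] h
    unfolding R_def by auto
  have dg: "degree g > 0"
  proof (rule ccontr)
    assume "\<not> degree g > 0"
    then obtain a where "g = [:a:]" by (auto elim: degree_eq_zeroE)
    then show False using g by auto
  qed
  \<comment> \<open>A leading coefficient outside \<open>M\<close> could be normalised to
    \<open>1\<close>, against the minimality of \<open>g\<close>; one inside \<open>M\<close> is
    stripped off, and the argument repeats.\<close>
  have small: "r \<in> polys M" if "r \<in> polys R" "degree r < degree g" "poly r x \<in> M" for r
    using that
  proof (induction "degree r" arbitrary: r rule: less_induct)
    case less
    define a where "a = lead_coeff r"
    define d where "d = degree r"
    have a: "a \<in> R" using less.prems polysD by (auto simp: a_def)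
    show ?case
    proof (cases "a \<in> M")
      case True
      define r1 where "r1 = r - monom a d"
      have r1R: "r1 \<in> polys R" unfolding r1_def
        using a less.prems by (intro R.polys_diff monom_polys) auto
      have "poly r1 x = poly r x - a * x ^ d" by (simp add: r1_def poly_monom)
      then have r1M: "poly r1 x \<in> M" using less.prems True M_mult x power_mem M_diff by simp
      have "r1 \<in> polys M"
      proof (cases "d = 0")
        case True
        then have "r1 = 0"
          by (auto simp: r1_def a_def d_def monom_0 elim: degree_eq_zeroE)
        then show ?thesis by (simp add: polys_def)
      next
        case False
        have "degree r1 \<le> d" unfolding r1_def
          by (intro degree_diff_le degree_monom_le) (simp add: d_def)
        moreover have "coeff r1 d = 0" by (simp add: r1_def a_def d_def)
        ultimately have "degree r1 < d" using False
          by (metis eq_zero_or_degree_less degree_0 not_gr_zero)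
        then show ?thesis using less r1R r1M by (auto simp: d_def)
      qed
      moreover have "coeff r i = coeff r1 i + (if d = i then a else 0)" for i by (simp add: r1_def)
      ultimately show ?thesis using True by (auto simp: polys_def intro!: M_add)
    next
      case False
      then have aU: "a \<in> units" using a V_cases by (auto simp: R_def)
      then have ia: "inverse a \<in> R" using a U.inverse_mem units_inverse units_V by (auto simp: R_def)
      have "degree g \<le> degree (smult (inverse a) r)"
      proof (rule gmin)
        show "smult (inverse a) r \<in> polys R" using ia less.prems R.polys_smult by blast
        show "lead_coeff (smult (inverse a) r) = 1" using units_nz[OF aU] by (simp add: a_def)
        show "poly (smult (inverse a) r) x \<in> M" using ia less.prems M_mult' by (auto simp: R_def)
      qed
      then show ?thesis using less.prems by (simp split: if_splits)
    qed
  qed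
  have divc: "\<exists>r1\<in>polys R. r = smult c r1" if "r \<in> polys R" "r \<in> polys M" for r
  proof (rule bexI[of _ "smult (inverse c) r"])
    show "smult (inverse c) r \<in> polys R"
      using uniformizer_divide[OF U(1,2)] that by (auto simp: polys_def R_def divide_inverse mult.commute[of "inverse c"])
  qed (use c in simp)
  obtain q r where qr: "q \<in> polys R" "r \<in> polys R" "h = g * q + r" "degree r < degree g"
    using R.monic_division[OF g(1,2) dg, of h] h by (auto simp: R_def)
  have "poly r x = - (poly g x * poly q x)" using h qr(3) by (simp add: add_eq_0_iff2)
  then have "poly r x \<in> M" using g qr evV M_mult M_uminus by simp
  then have rM: "r \<in> polys M" using small qr by blast
  then obtain r1 where r1: "r1 \<in> polys R" "r = smult c r1" using divc qr by blast
  \<comment> \<open>Differentiating \<open>h = g q + r\<close> at \<open>x\<close> leaves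
    \<open>g'(x) q(x)\<close> modulo \<open>M\<close>, as \<open>g(x)\<close> and all coefficients
    of \<open>r\<close> are in \<open>M\<close>. Since \<open>h'(x)\<close> is not in
    \<open>M\<close>, neither is \<open>q(x)\<close>.\<close>
  have qU: "poly q x \<in> units"
  proof -
    have "pderiv r \<in> polys M"
      using rM by (auto simp: polys_def coeff_pderiv simp del: of_nat_Suc intro!: M_mult')
    then have 1: "poly (pderiv r) x \<in> M" using poly_M x by blast
    have 2: "poly g x * poly (pderiv q) x \<in> M"
      using g evV[OF R.polys_pderiv[OF qr(1)]] M_mult by blast
    have "poly (pderiv h) x = poly (pderiv g) x * poly q x + (poly g x * poly (pderiv q) x + poly (pderiv r) x)"
      by (simp add: qr pderiv_add pderiv_mult algebra_simps)
    then have "poly (pderiv g) x * poly q x \<notin> M" using h(4) 1 2 M_add by metis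
    then have "poly q x \<notin> M" using evV[OF R.polys_pderiv[OF g(1)]] M_mult' by blast
    then show ?thesis using V_cases evV qr by blast
  qed
  \<comment> \<open>In \<open>s = g qs + rs\<close>, multiplied by \<open>q\<close>, the first
    summand gains a factor \<open>c\<close> from \<open>g(x) q(x) = - c r1(x)\<close>; the second
    has it already, since the coefficients of \<open>rs\<close> lie in \<open>M\<close>.\<close>
  have step: "\<exists>t\<in>polys R. poly q x * poly s x = c * poly t x" if s: "s \<in> polys R" "poly s x \<in> M" for s
  proof -
    obtain qs rs where qrs: "qs \<in> polys R" "rs \<in> polys R" "s = g * qs + rs" "degree rs < degree g"
      using R.monic_division[OF g(1,2) dg s(1)] by auto
    have "poly s x - poly g x * poly qs x \<in> M" by (intro M_diff M_mult s g evV qrs)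
    then have "poly rs x \<in> M" by (simp add: qrs(3))
    then obtain t where t: "t \<in> polys R" "rs = smult c t" using divc qrs small by blast
    have gq: "poly g x * poly q x = - c * poly r1 x"
      using h qr(3) r1 by (simp add: add_eq_0_iff)
    have "poly q x * poly s x = poly g x * poly q x * poly qs x + poly q x * (c * poly t x)"
      by (simp add: qrs(3) t algebra_simps)
    also have "\<dots> = c * poly (q * t - r1 * qs) x"
      unfolding gq by (simp add: algebra_simps)
    finally have "poly q x * poly s x = c * poly (q * t - r1 * qs) x" .
    moreover have "q * t - r1 * qs \<in> polys R"
      by (intro R.polys_diff R.polys_mult qr r1 t qrs)
    ultimately show ?thesis by blast
  qed
  \<comment> \<open>\<open>N\<close> bounds the value of \<open>s(x)\<close> and drops by one
    whenever a factor \<open>c\<close> is split off.\<close>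
  have descent: "\<exists>k::int. poly s x / c powi k \<in> units"
    if "s \<in> polys R" "poly s x \<noteq> 0" "c ^ N / poly s x \<in> V" for s N
    using that
  proof (induction N arbitrary: s)
    case 0
    then have "poly s x \<in> units" using evV by (auto simp: units_def inverse_eq_divide)
    then show ?case by (intro exI[of _ 0]) simp
  next
    case (Suc N)
    show ?case
    proof (cases "poly s x \<in> M")
      case False
      then have "poly s x \<in> units" using evV V_cases Suc by blast
      then show ?thesis by (intro exI[of _ 0]) simp
    next
      case True
      then obtain t where t: "t \<in> polys R" "poly q x * poly s x = c * poly t x" using step Suc by blast
      have q0: "poly q x \<noteq> 0" using qU units_nz by blast
      have sx: "poly s x = c * poly t x / poly q x" using t(2) q0 by (simp add: field_simps)
      have t0: "poly t x \<noteq> 0" using Suc(3) sx by auto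
      have "(c ^ Suc N / poly s x) * inverse (poly q x) \<in> V"
        using Suc(4) units_inverse[OF qU] units_V mult_mem by blast
      also have "(c ^ Suc N / poly s x) * inverse (poly q x) = c ^ N / poly t x"
        using q0 t0 c unfolding sx by (simp add: field_simps)
      finally obtain k :: int where k: "poly t x / c powi k \<in> units" using Suc.IH[OF t(1) t0] by blast
      have "(poly t x / c powi k) / poly q x \<in> units" using k qU units_divide by blast
      also have "(poly t x / c powi k) / poly q x = poly s x / c powi (k + 1)"
        using c q0 unfolding sx by (simp add: power_int_add field_simps)
      finally show ?thesis by blast
    qed
  qed
  have clear: "\<exists>n. smult (c ^ n) s \<in> polys R" if "s \<in> polys U" for s
    using that
  proof (induction s)
    case (pCons a s)
    have aU: "a \<in> U" using polysD[OF pCons.prems, of 0] by simp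
    have "coeff s i \<in> U" for i using polysD[OF pCons.prems, of "Suc i"] by simp
    then have "s \<in> polys U" by (simp add: polys_def)
    then obtain n where n: "smult (c ^ n) s \<in> polys R" using pCons.IH by blast
    have "\<exists>m. c ^ m * a \<in> V"
    proof (cases "a = 0")
      case False
      then obtain k :: int where k: "a / c powi k \<in> units" using aU U by (auto simp: uniformizer_def)
      have "(a / c powi k) * c powi (k + int (nat (- k))) \<in> V"
        using k units_V units_powi_M[OF c(2,3)] by (intro mult_mem) auto
      moreover have "c powi (k + int (nat (- k))) = c powi k * c ^ nat (- k)"
        by (subst power_int_add) (use c in \<open>auto simp del: int_nat_eq\<close>)
      then have "(a / c powi k) * c powi (k + int (nat (- k))) = c ^ nat (- k) * a"
        using c by simp
      ultimately show ?thesis by metis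
    qed auto
    then obtain m where m: "c ^ m * a \<in> V" by blast
    have "smult (c ^ (m + n)) (pCons a s) = pCons (c ^ n * (c ^ m * a)) (smult (c ^ m) (smult (c ^ n) s))"
      by (simp add: power_add mult_ac)
    moreover have "c ^ m * a \<in> R" using m c aU by (auto simp: R_def intro!: U.mult_mem U.power_mem)
    then have "pCons (c ^ n * (c ^ m * a)) (smult (c ^ m) (smult (c ^ n) s)) \<in> polys R"
      by (rule R.polys_pCons[OF R.mult_mem[OF R.power_mem[OF c(4)]] R.polys_smult[OF R.power_mem[OF c(4)] n]])
    ultimately show ?case by metis
  qed auto
  have alg: "algebraic (poly r x)" if "r \<in> polys U" for r
  proof -
    interpret Q: sfield "{x::complex. algebraic x}" by (rule sfield_algebraic)
    show ?thesis using that U(3) x(2) Q.poly_mem[of r x] polys_mono by blast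
  qed
  obtain n where n: "smult (c ^ n) s \<in> polys R" using clear s by blast
  define s1 where "s1 = smult (c ^ n) s"
  have s1: "poly s1 x \<noteq> 0" "s1 \<in> polys R" using s c n by (auto simp: s1_def)
  have "algebraic (poly s1 x)" using alg s1 polys_mono[of R U] by (auto simp: R_def)
  then obtain e where e: "of_nat p ^ e / poly s1 x \<in> V"
    using algebraic_dvd_p_power s1 evV by metis
  have "(of_nat p :: complex) \<noteq> 0" by simp
  then have "\<exists>m::int. of_nat p / c powi m \<in> units"
    using U(2) U.of_nat_mem[of p] unfolding uniformizer_def by blast
  then obtain m :: int where m: "of_nat p / c powi m \<in> units" by blast
  have "of_nat p * inverse (of_nat p / c powi m) \<in> V" using m units_inverse units_V mult_mem of_nat_mem by blast
  then have m0: "m \<ge> 0" using units_powi_M(1)[OF c(2,3), of m] by simp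
  have "(of_nat p ^ e / poly s1 x) * inverse ((of_nat p / c powi m) ^ e) \<in> V"
    using e units_V[OF units_inverse[OF units_power[OF m]]] mult_mem by blast
  also have "(of_nat p ^ e / poly s1 x) * inverse ((of_nat p / c powi m) ^ e) = c ^ (nat m * e) / poly s1 x"
    using m0 by (simp add: power_divide power_mult power_int_def)
  finally obtain k where k: "poly s1 x / c powi k \<in> units" using descent s1 by blast
  have "poly s1 x / c powi k = poly s x / c powi (k - int n)"
    using c by (simp add: s1_def power_int_diff)
  then show ?thesis using k by metis
qed

end

section \<open>Strictly henselian fields and trinomials\<close>

lemma (in sring) prod_linear_polys: "set_mset B \<subseteq> A \<Longrightarrow> (\<Prod>z\<in>#B. [:-z, 1:]) \<in> polys A"
  by (induction B) (auto intro!: polys_mult polys_pCons uminus_mem simp del: mult_pCons_left)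

lemma pderiv_linear_mult: "pderiv ([:-a, 1:] * q) = q + [:-a, 1:] * pderiv q"
  for a :: "'a::idom"
  unfolding pderiv_mult by (simp add: pderiv_pCons)

definition fractions :: "'a::field set \<Rightarrow> 'a set" where
  "fractions A = {a / b | a b. a \<in> A \<and> b \<in> A \<and> b \<noteq> 0}"

lemma fractionsI: "a \<in> A \<Longrightarrow> b \<in> A \<Longrightarrow> b \<noteq> 0 \<Longrightarrow> a / b \<in> fractions A"
  unfolding fractions_def by blast

lemma (in sring) sfield_fractions: "sfield (fractions A)"
proof
  show "1 \<in> fractions A"
    using fractionsI[of 1 A 1] by simp
next
  fix x y assume "x \<in> fractions A" "y \<in> fractions A"
  then obtain a b c d where *: "a \<in> A" "b \<in> A" "b \<noteq> 0" "x = a / b" "c \<in> A" "d \<in> A" "d \<noteq> 0" "y = c / d"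
    unfolding fractions_def by blast
  have "x - y = (a * d - c * b) / (b * d)" "x * y = (a * c) / (b * d)" using * by (simp_all add: field_simps)
  moreover have "(a * d - c * b) / (b * d) \<in> fractions A" "(a * c) / (b * d) \<in> fractions A"
    using * by (intro fractionsI diff_mem mult_mem; simp)+
  ultimately show "x - y \<in> fractions A" "x * y \<in> fractions A" by simp_all
next
  fix x assume "x \<in> fractions A"
  then obtain a b where *: "a \<in> A" "b \<in> A" "b \<noteq> 0" "x = a / b"
    unfolding fractions_def by blast
  show "inverse x \<in> fractions A"
  proof (cases "a = 0")
    case True
    then show ?thesis using * fractionsI[of 0 A 1] by simp
  next
    case False
    then show ?thesis using * fractionsI[of b A a] by simp
  qed
qed

lemma (in sring) subset_fractions: "A \<subseteq> fractions A"
proof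
  fix x assume "x \<in> A"
  then have "x / 1 \<in> fractions A" by (intro fractionsI) auto
  then show "x \<in> fractions A" by simp
qed

lemma (in sfield) fractions_subset: "A \<subseteq> K \<Longrightarrow> fractions A \<subseteq> K"
  unfolding fractions_def using divide_mem by auto

text \<open>
  A field that is maximal among the fields with the given uniformizer behaves like a strict
  henselisation: the roots of polynomials that are separable modulo the maximal ideal lie in it.
\<close>
locale strictly_henselian = cvalring + U: sfield U for U :: "complex set" +
  fixes c :: complex
  assumes unif: "uniformizer c U"
    and alg: "U \<subseteq> {x. algebraic x}"
    and etale: "\<lbrakk>x \<in> V; algebraic x; h \<in> polys (U \<inter> V); lead_coeff h = 1; poly h x = 0;
      poly (pderiv h) x \<notin> M\<rbrakk> \<Longrightarrow> x \<in> U"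

text \<open>If a simple root \<open>x\<close> were missing from a maximal \<open>U\<close>, the
  field generated by \<open>U\<close> and \<open>x\<close> would be a larger candidate by
  \<open>etale_value\<close>.\<close>

lemma (in cvalring) strictly_henselian_extension:
  assumes K: "sfield K" "uniformizer c K" "K \<subseteq> {x. algebraic x}"
  shows "\<exists>U. K \<subseteq> U \<and> strictly_henselian V p U c"
proof -
  define S where "S = {U. K \<subseteq> U \<and> sfield U \<and> uniformizer c U \<and> U \<subseteq> {x. algebraic x}}"
  have "\<exists>M\<in>S. \<forall>B\<in>S. M \<subseteq> B \<longrightarrow> B = M"
  proof (rule subset_Zorn_nonempty)
    show "S \<noteq> {}" using K by (auto simp: S_def)
  next
    fix C assume C: "C \<noteq> {}" "subset.chain S C"
    have CS: "\<And>A. A \<in> C \<Longrightarrow> A \<in> S" using C by (auto simp: subset_chain_def)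
    have two: "\<exists>A\<in>C. x \<in> A \<and> y \<in> A" if "x \<in> \<Union>C" "y \<in> \<Union>C" for x y
    proof -
      from that obtain B D where BD: "B \<in> C" "D \<in> C" "x \<in> B" "y \<in> D" by auto
      then have "B \<subseteq> D \<or> D \<subseteq> B" using C by (auto simp: subset_chain_def)
      with BD show ?thesis by blast
    qed
    obtain A where A: "A \<in> C" using C by blast
    have Af: "sfield A" "uniformizer c A" "K \<subseteq> A" using CS[OF A] by (auto simp: S_def)
    have "sfield (\<Union>C)"
    proof
      show "1 \<in> \<Union>C" using A sring.one_mem[OF sfield.axioms(1)[OF Af(1)]] by blast
    next
      fix x y assume "x \<in> \<Union>C" "y \<in> \<Union>C"
      then obtain B where B: "B \<in> C" "x \<in> B" "y \<in> B" using two by blast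
      then interpret B: sfield B using CS by (auto simp: S_def)
      show "x - y \<in> \<Union>C" "x * y \<in> \<Union>C" using B B.diff_mem B.mult_mem by blast+
    next
      fix x assume "x \<in> \<Union>C"
      then obtain B where B: "B \<in> C" "x \<in> B" by blast
      then interpret B: sfield B using CS by (auto simp: S_def)
      show "inverse x \<in> \<Union>C" using B B.inverse_mem by blast
    qed
    moreover have "uniformizer c (\<Union>C)" using CS A by (fastforce simp: S_def uniformizer_def)
    ultimately show "\<Union>C \<in> S" using CS A by (auto simp: S_def)
  qed
  then obtain U where U: "U \<in> S" and max: "\<And>B. B \<in> S \<Longrightarrow> U \<subseteq> B \<Longrightarrow> B = U" by blast
  have Uf: "sfield U" "uniformizer c U" "K \<subseteq> U" "U \<subseteq> {x. algebraic x}" using U by (auto simp: S_def)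
  interpret U: sfield U by fact
  have "x \<in> U" if x: "x \<in> V" "algebraic x" and h: "h \<in> polys (U \<inter> V)" "lead_coeff h = 1" "poly h x = 0"
      "poly (pderiv h) x \<notin> M" for x h
  proof -
    interpret A: sring "U.adjoin x" by (rule U.sring_adjoin)
    \<comment> \<open>Taking quotients gives a field without a proof that U[x] already is one; the
      exponents of \<open>c\<close> simply subtract.\<close>
    define F where "F = fractions (U.adjoin x)"
    have F: "sfield F" unfolding F_def by (rule A.sfield_fractions)
    have UF: "U \<subseteq> F" "x \<in> F"
      unfolding F_def using U.subset_adjoin U.mem_adjoin A.subset_fractions by blast+
    have val: "\<exists>k::int. a / c powi k \<in> units" if "a \<in> U.adjoin x" "a \<noteq> 0" for a
      using that etale_value[OF Uf(1,2,4) x h] by (auto simp: U.adjoin_def)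
    have "\<exists>k::int. y / c powi k \<in> units" if y: "y \<in> F" "y \<noteq> 0" for y
    proof -
      obtain a b where ab: "a \<in> U.adjoin x" "b \<in> U.adjoin x" "b \<noteq> 0" "y = a / b"
        using y by (auto simp: F_def fractions_def)
      obtain k l :: int where kl: "a / c powi k \<in> units" "b / c powi l \<in> units"
        using val[of a] val[of b] ab y by auto
      have "(a / c powi k) / (b / c powi l) \<in> units" by (rule units_divide[OF kl])
      also have "(a / c powi k) / (b / c powi l) = y / c powi (k - l)"
        using Uf(2) by (simp add: ab power_int_diff uniformizer_def)
      finally show ?thesis by blast
    qed
    then have "uniformizer c F" using Uf(2) UF by (auto simp: uniformizer_def)
    moreover have "F \<subseteq> {x. algebraic x}"
    proof -
      interpret Q: sfield "{x::complex. algebraic x}" by (rule sfield_algebraic)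
      have "U.adjoin x \<subseteq> {x. algebraic x}"
        unfolding U.adjoin_def using Q.poly_mem[of _ x] x(2) polys_mono[OF Uf(4)] by blast
      then show ?thesis unfolding F_def by (rule Q.fractions_subset)
    qed
    ultimately have "F \<in> S" using F UF Uf by (auto simp: S_def)
    then show "x \<in> U" using max UF by blast
  qed
  then have "strictly_henselian V p U c"
    using Uf by unfold_locales auto
  then show ?thesis using Uf by blast
qed

context strictly_henselian
begin

lemma c_facts: "c \<in> U" "c \<in> M" "c \<noteq> 0"
  using unif by (auto simp: uniformizer_def)

text \<open>\<open>T^2 - x^2\<close> has derivative \<open>2 x\<close> at \<open>x\<close>, a unit
  when the residue characteristic is not 2.\<close>

lemma sqrt_unit:
  assumes "2 \<notin> M" "x ^ 2 \<in> U" "x ^ 2 \<in> units"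
  shows "x \<in> U"
proof (rule etale)
  have x: "x \<in> units" using units_power_cancel[of 2] assms by simp
  then show "x \<in> V" by (rule units_V)
  show "algebraic x"
    by (rule algebraic_root[of "x ^ 2" "monom 1 2"]) (use assms alg in \<open>auto simp: poly_monom degree_monom_eq\<close>)
  show "[:- (x ^ 2), 0, 1:] \<in> polys (U \<inter> V)"
    using U.uminus_mem[OF assms(2)] uminus_mem[OF units_V[OF assms(3)]]
    by (auto simp: polys_def coeff_pCons split: nat.splits)
  have "2 * x \<in> units" using assms(1) x V_cases[of 2] units_mult by auto
  then show "poly (pderiv [:- (x ^ 2), 0, 1:]) x \<notin> M"
    using units_not_M by (simp add: pderiv_pCons mult.commute)
qed (auto simp: power2_eq_square)

text \<open>Multiplicities modulo \<open>M\<close> are read off from products of differences of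
  complex roots, so no residue field is formed. The \<open>a\<close> of the second case is the
  midpoint of \<open>x\<close> and the root \<open>y\<close> congruent to it.\<close>

lemma trinomial_root_cases:
  assumes n: "n \<ge> 2" and x: "x ^ n = x + 1"
  shows "x \<in> U \<or> 2 \<notin> M \<and> (\<exists>a\<in>U. (x - a) ^ 2 \<in> U)"
proof -
  define f :: "complex poly" where "f = monom 1 n - [:1, 1:]"
  have fx: "poly f z = z ^ n - (z + 1)" for z by (simp add: f_def poly_monom)
  have df: "poly (pderiv f) z = of_nat n * z ^ (n - 1) - 1" for z
    by (simp add: f_def pderiv_diff pderiv_monom poly_monom pderiv_pCons)
  have deg: "degree f = n" and lc: "lead_coeff f = 1"
  proof -
    have "degree (monom (1::complex) n) = n" by (simp add: degree_monom_eq)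
    moreover have "degree [:1, 1::complex:] < degree (monom (1::complex) n)"
      using n by (simp add: degree_monom_eq)
    ultimately show "degree f = n"
      unfolding f_def using degree_add_eq_left[of "- [:1, 1:]" "monom (1::complex) n"]
      unfolding degree_minus diff_conv_add_uminus by (simp only:)
    then show "lead_coeff f = 1" unfolding f_def
      using n by (auto simp: coeff_pCons split: nat.splits)
  qed
  have Z: "coeff f i \<in> \<int>" for i by (auto simp: f_def coeff_pCons split: nat.splits)
  have "coeff f i \<in> U \<inter> V" for i using Z[of i] by (auto elim!: Ints_cases)
  then have fUV: "f \<in> polys (U \<inter> V)" by (simp add: polys_def)
  have ai: "algebraic_int z" if "poly f z = 0" for z
    using Z lc that by (auto simp: algebraic_int.simps)
  have zV: "z \<in> V" if "poly f z = 0" for z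
    using ai[OF that] algebraic_int_mem_valring[OF valring_axioms] by blast
  have zU: "z \<in> U" if "poly f z = 0" "poly (pderiv f) z \<notin> M" for z
    using etale[OF zV _ fUV lc] ai that by blast
  have x0: "poly f x = 0" by (simp add: fx x)
  have xV: "x \<in> V" using zV x0 by blast
  show ?thesis
  proof (cases "poly (pderiv f) x \<in> M")
    case False
    then show ?thesis using zU x0 by blast
  next
    case True
    \<comment> \<open>On a root, \<open>z f'(z) = n z^n - z = (n - 1) z + n\<close>; once
      \<open>n - 1\<close> is a unit, this fixes the residue class of a multiple root.\<close>
    have crit: "of_nat (n - 1) * z + of_nat n \<in> M" if z: "poly f z = 0" "poly (pderiv f) z \<in> M" for z
    proof -
      have "(of_nat n * z ^ (n - 1) - 1) * z \<in> M" using z zV M_mult df by simp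
      also have "(of_nat n * z ^ (n - 1) - 1) * z = of_nat n * (z ^ (n - 1) * z) - z"
        by (simp add: algebra_simps)
      also have "z ^ (n - 1) * z = z + 1"
        using z(1) n by (simp add: fx flip: power_Suc2)
      also have "of_nat n * (z + 1) - z = of_nat (n - 1) * z + of_nat n"
        using n by (simp add: algebra_simps of_nat_diff)
      finally show ?thesis .
    qed
    \<comment> \<open>\<open>n x^(n-1)\<close> is \<open>1\<close> modulo \<open>M\<close>, which
      excludes \<open>n\<close> in \<open>M\<close>; and \<open>n - 1\<close> in \<open>M\<close>
      would by \<open>crit\<close> put \<open>n\<close> there too.\<close>
    have nM: "of_nat n \<notin> M"
    proof
      assume "of_nat n \<in> M"
      then have "of_nat n * x ^ (n - 1) - (of_nat n * x ^ (n - 1) - 1) \<in> M"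
        using True unfolding df by (rule M_diff[OF M_mult[OF _ power_mem[OF xV]]])
      then show False by simp
    qed
    have n1M: "of_nat (n - 1) \<notin> M"
    proof
      assume "of_nat (n - 1) \<in> M"
      then have "(of_nat (n - 1) * x + of_nat n) - of_nat (n - 1) * x \<in> M"
        using crit[OF x0 True] M_diff M_mult xV by blast
      then show False using nM by simp
    qed
    \<comment> \<open>One of two consecutive integers is even, so residue characteristic 2 admits no
      multiple root.\<close>
    have "even n \<or> even (n - 1)" using n by auto
    then have two: "2 \<notin> M"
    proof
      assume "even n"
      then obtain m where "n = 2 * m" by auto
      then show ?thesis using nM M_mult[of 2 "of_nat m"] by auto
    next
      assume "even (n - 1)"
      then obtain m where m: "n - 1 = 2 * m" by (elim evenE)
      show ?thesis using n1M M_mult[of 2 "of_nat m"] unfolding m by auto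
    qed
    obtain g where g: "f = [:-x, 1:] * g" using x0 by (auto simp: poly_eq_0_iff_dvd elim: dvdE)
    have "f \<noteq> 0" using lc by auto
    then have "g \<noteq> 0" using g by auto
    moreover have "lead_coeff g = 1" using lc unfolding g lead_coeff_mult by simp
    ultimately obtain A where A: "g = (\<Prod>z\<in>#A. [:-z, 1:])"
      using alg_closed_imp_factorization[of g] by auto
    have rootA: "poly f z = 0" if "z \<in># A" for z
    proof -
      from that obtain B where "A = add_mset z B" by (metis insert_DiffM)
      then show ?thesis by (simp add: g A)
    qed
    have prodM: "\<exists>z\<in>#B. x - z \<in> M" if "set_mset B \<subseteq> set_mset A" "poly (\<Prod>z\<in>#B. [:-z, 1:]) x \<in> M" for B
      using that
    proof (induction B)
      case (add z B)
      have BA: "z \<in># A" "set_mset B \<subseteq> set_mset A" using add.prems(1) by auto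
      have "x - z \<in> V" using xV zV rootA BA diff_mem by blast
      moreover have "set_mset B \<subseteq> V" using BA zV rootA by auto
      then have "poly (\<Prod>z\<in>#B. [:-z, 1:]) x \<in> V" using xV poly_mem prod_linear_polys by blast
      ultimately show ?case using add M_prime[of "x - z"] BA by (auto simp: left_diff_distrib)
    qed auto
    \<comment> \<open>\<open>f'(x)\<close> is the product of the differences of \<open>x\<close> and
      the remaining roots; \<open>M\<close> is prime, so one of these roots, \<open>y\<close>, is
      congruent to \<open>x\<close>.\<close>
    have "poly (pderiv f) x = poly g x" unfolding g pderiv_linear_mult by simp
    then obtain y where y: "y \<in># A" "x - y \<in> M" using prodM[of A] True by (auto simp: A)
    then obtain B where B: "A = add_mset y B" by (metis insert_DiffM)
    define k where "k = (\<Prod>z\<in>#B. [:-z, 1:])"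
    have gk: "g = [:-y, 1:] * k" by (simp add: A B k_def)
    have kV: "k \<in> polys V"
      unfolding k_def by (rule prod_linear_polys) (use zV rootA B in auto)
    \<comment> \<open>A third root congruent to \<open>x\<close> would give \<open>f''(x)\<close> in
      \<open>M\<close>, but \<open>f''(x) = n (n-1) x^(n-2)\<close> is a unit.\<close>
    have kM: "poly k x \<notin> M"
    proof
      assume *: "poly k x \<in> M"
      have "poly (pderiv (pderiv f)) x = 2 * (poly k x + (x - y) * poly (pderiv k) x)"
        unfolding g gk pderiv_linear_mult pderiv_add by (simp add: algebra_simps)
      moreover have "poly k x + (x - y) * poly (pderiv k) x \<in> M"
        using * y kV xV by (intro M_add M_mult poly_mem polys_pderiv)
      then have "2 * (poly k x + (x - y) * poly (pderiv k) x) \<in> M" by (rule M_mult'[OF numeral_mem])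
      ultimately have "poly (pderiv (pderiv f)) x \<in> M" by (simp only:)
      moreover have "poly (pderiv (pderiv f)) x = of_nat n * of_nat (n - 1) * x ^ (n - 2)"
        by (simp add: f_def pderiv_diff pderiv_monom poly_monom pderiv_pCons diff_diff_eq numeral_2_eq_2)
      moreover have "of_nat n \<in> units" "of_nat (n - 1) \<in> units" using nM n1M V_cases of_nat_mem by blast+
      moreover have "x \<in> units"
      proof -
        have "x * (x ^ (n - 1) - 1) = x ^ n - x" using n by (cases n) (auto simp: algebra_simps)
        then have "x * (x ^ (n - 1) - 1) = 1" using x by simp
        then show ?thesis
          using units_mult_M[OF xV, of "x ^ (n - 1) - 1"] xV by (simp add: diff_mem power_mem)
      qed
      ultimately show False using units_mult[OF units_mult units_power] units_not_M by metis
    qed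
    \<comment> \<open>By \<open>crit\<close> a further multiple root \<open>z\<close> would be
      congruent to \<open>x\<close>, so that the factor \<open>x - z\<close> would put
      \<open>k(x)\<close> into \<open>M\<close>, against \<open>kM\<close>.\<close>
    have BU: "z \<in> U" if zB: "z \<in># B" for z
    proof (rule zU)
      show z0: "poly f z = 0" using zB rootA B by auto
      show "poly (pderiv f) z \<notin> M"
      proof
        assume z1: "poly (pderiv f) z \<in> M"
        have "(of_nat (n - 1) * x + of_nat n) - (of_nat (n - 1) * z + of_nat n) \<in> M"
          by (rule M_diff[OF crit[OF x0 True] crit[OF z0 z1]])
        also have "(of_nat (n - 1) * x + of_nat n) - (of_nat (n - 1) * z + of_nat n) = of_nat (n - 1) * (x - z)"
          by (simp add: algebra_simps)
        finally have "x - z \<in> M"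
          using M_prime[OF of_nat_mem diff_mem[OF xV zV[OF z0]]] n1M by blast
        obtain D where D: "B = add_mset z D" using zB by (meson multi_member_split)
        have "set_mset D \<subseteq> V" using zV rootA by (auto simp: B D)
        then have "(\<Prod>z\<in>#D. [:-z, 1:]) \<in> polys V" by (rule prod_linear_polys)
        then have "(x - z) * poly (\<Prod>z\<in>#D. [:-z, 1:]) x \<in> M"
          using xV poly_mem \<open>x - z \<in> M\<close> M_mult by blast
        also have "(x - z) * poly (\<Prod>z\<in>#D. [:-z, 1:]) x = poly k x"
          unfolding k_def D by (simp add: left_diff_distrib)
        finally show False using kM by blast
      qed
    qed
    have kU: "k \<in> polys U"
      unfolding k_def by (rule U.prod_linear_polys) (use BU in auto)
    \<comment> \<open>Both \<open>f(0)\<close> and \<open>f(1)\<close> equal \<open>-1\<close>. With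
      \<open>f = (T - x) (T - y) k\<close> and \<open>k\<close> over \<open>U\<close>, they yield
      \<open>x y\<close> and \<open>(1 - x) (1 - y)\<close> in \<open>U\<close>, hence also
      \<open>x + y\<close>.\<close>
    have k01: "poly k 0 \<in> U" "poly k 1 \<in> U" using kU U.poly_mem by auto
    have e0: "x * y * poly k 0 = - 1" using fx[of 0] n by (simp add: g gk power_0_left mult.assoc)
    have e1: "(1 - x) * (1 - y) * poly k 1 = - 1" using fx[of 1] by (simp add: g gk algebra_simps)
    have inv: "a \<in> U" if "a * b = - 1" "b \<in> U" for a b
    proof -
      have "b \<noteq> 0" using that by auto
      then have "a = - 1 / b" using that by (simp add: field_simps)
      then show ?thesis using that by (metis U.divide_mem U.uminus_mem U.one_mem)
    qed
    have xy: "x * y \<in> U" using inv e0 k01 by blast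
    have "(1 - x) * (1 - y) \<in> U" using inv e1 k01 by blast
    then have "1 + x * y - (1 - x) * (1 - y) \<in> U" using xy by (intro U.diff_mem U.add_mem) auto
    also have "1 + x * y - (1 - x) * (1 - y) = x + y" by (simp add: algebra_simps)
    finally have a: "(x + y) / 2 \<in> U" by (intro U.divide_mem) auto
    have "((x + y) / 2) * ((x + y) / 2) - x * y \<in> U" using a xy U.diff_mem U.mult_mem by blast
    also have "((x + y) / 2) * ((x + y) / 2) - x * y = (x - (x + y) / 2) ^ 2"
      by (simp add: power2_eq_square field_simps)
    finally show ?thesis using two a by blast
  qed
qed

section \<open>The ramified quadratic extension of \<open>U\<close>\<close>

definition quadratic :: "complex \<Rightarrow> complex set" where
  "quadratic \<gamma> = {a + b * \<gamma> | a b. a \<in> U \<and> b \<in> U}"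

lemma quadraticI: "a \<in> U \<Longrightarrow> b \<in> U \<Longrightarrow> a + b * \<gamma> \<in> quadratic \<gamma>"
  by (auto simp: quadratic_def)

lemma quadraticE:
  assumes "x \<in> quadratic \<gamma>"
  obtains a b where "a \<in> U" "b \<in> U" "x = a + b * \<gamma>"
  using assms by (auto simp: quadratic_def)

lemma subset_quadratic: "U \<subseteq> quadratic \<gamma>"
proof
  fix a assume "a \<in> U"
  then show "a \<in> quadratic \<gamma>" using quadraticI[of a 0] by simp
qed

lemma sfield_quadratic:
  assumes \<gamma>: "\<gamma> ^ 2 = c"
  shows "sfield (quadratic \<gamma>)"
proof
  show "1 \<in> quadratic \<gamma>" using subset_quadratic U.one_mem by blast
next
  fix x y assume "x \<in> quadratic \<gamma>" "y \<in> quadratic \<gamma>"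
  then obtain a b d e where *: "a \<in> U" "b \<in> U" "x = a + b * \<gamma>" "d \<in> U" "e \<in> U" "y = d + e * \<gamma>"
    by (elim quadraticE)
  have "x - y = (a - d) + (b - e) * \<gamma>" using * by (simp add: algebra_simps)
  then show "x - y \<in> quadratic \<gamma>"
    using quadraticI[OF U.diff_mem[OF *(1,4)] U.diff_mem[OF *(2,5)]] by (simp only:)
  have "x * y = (a * d + b * e * c) + (a * e + b * d) * \<gamma>"
    using * by (simp add: algebra_simps flip: \<gamma>) (simp add: power2_eq_square)
  moreover have "a * d + b * e * c \<in> U" "a * e + b * d \<in> U"
    using * c_facts by (auto intro!: U.add_mem U.mult_mem)
  ultimately show "x * y \<in> quadratic \<gamma>" using quadraticI by (simp only:)
next
  fix x assume "x \<in> quadratic \<gamma>"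
  then obtain a b where ab: "a \<in> U" "b \<in> U" "x = a + b * \<gamma>" by (elim quadraticE)
  define N where "N = a ^ 2 - b ^ 2 * c"
  have NU: "N \<in> U" unfolding N_def using ab c_facts by (intro U.diff_mem U.mult_mem U.power_mem)
  have xN: "x * (a - b * \<gamma>) = N"
    unfolding N_def ab \<gamma>[symmetric] by (simp add: algebra_simps power2_eq_square)
  show "inverse x \<in> quadratic \<gamma>"
  proof (cases "N = 0")
    case False
    then have "x \<noteq> 0" using xN by auto
    then have "inverse x = a / N + (- (b / N)) * \<gamma>" using xN False by (simp add: field_simps)
    then show ?thesis using ab NU quadraticI U.divide_mem U.uminus_mem by metis
  next
    case True
    show ?thesis
    proof (cases "b = 0")
      case False
      \<comment> \<open>Norm zero with \<open>b\<close> nonzero would put \<gamma> into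
        \<open>U\<close>, and \<open>x\<close> with it; no parity argument is needed to settle this
        case.\<close>
      then have "\<gamma> ^ 2 = (a / b) ^ 2" using True \<gamma> by (simp add: N_def field_simps)
      then have "\<gamma> = a / b \<or> \<gamma> = - (a / b)" by (simp add: power2_eq_iff)
      then have "\<gamma> \<in> U" using ab U.divide_mem U.uminus_mem by metis
      then have "inverse x \<in> U" unfolding ab using ab U.inverse_mem U.add_mem U.mult_mem by metis
      then show ?thesis using subset_quadratic by blast
    next
      case True
      then have "inverse x \<in> U" using ab U.inverse_mem by simp
      then show ?thesis using subset_quadratic by blast
    qed
  qed
qed

lemma sqrt_mem_quadratic:
  assumes "\<gamma> ^ 2 = c" "2 \<notin> M" "x ^ 2 \<in> U"
  shows "x \<in> quadratic \<gamma>"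
proof (cases "x = 0")
  case False
  then obtain k :: int where k: "x ^ 2 / c powi k \<in> units"
    using unif assms(3) by (auto simp: uniformizer_def)
  define e where "e = nat (k mod 2)"
  \<comment> \<open>A square root of \<open>c powi k\<close> in U(\<gamma>), for either parity of
    \<open>k\<close>; dividing \<open>x\<close> by it leaves a square root of a unit, to which
    \<open>sqrt_unit\<close> applies.\<close>
  define d where "d = c powi (k div 2) * \<gamma> ^ e"
  have "k = 2 * (k div 2) + int e" by (simp add: e_def)
  then have "c powi k = c powi (2 * (k div 2) + int e)" by simp
  also have "\<dots> = (c powi (k div 2)) ^ 2 * c ^ e"
    using c_facts by (simp add: power_int_add power_int_mult mult.commute[of 2] power_int_power)
  also have "\<dots> = d ^ 2"
    by (simp add: d_def power_mult_distrib flip: assms(1) power_mult) (simp add: mult.commute)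
  finally have kd: "c powi k = d ^ 2" .
  have d0: "d \<noteq> 0" using kd c_facts by auto
  have "x / d \<in> U"
  proof (rule sqrt_unit[OF assms(2)])
    show "(x / d) ^ 2 \<in> units" using k by (simp add: kd power_divide)
    have "x ^ 2 / c powi k \<in> U" using assms(3) c_facts by (intro U.divide_mem U.powi_mem)
    then show "(x / d) ^ 2 \<in> U" by (simp add: kd power_divide)
  qed
  moreover interpret Q: sfield "quadratic \<gamma>" using sfield_quadratic assms(1) .
  have "\<gamma> \<in> quadratic \<gamma>" using quadraticI[of 0 1] by simp
  then have "d \<in> quadratic \<gamma>" unfolding d_def
    using subset_quadratic c_facts by (intro Q.mult_mem Q.powi_mem Q.power_mem) auto
  ultimately have "x / d * d \<in> quadratic \<gamma>" using subset_quadratic Q.mult_mem by blast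
  then show ?thesis using d0 by simp
qed (use subset_quadratic U.zero_mem in blast)

text \<open>Measured by the value of \<open>c\<close>, a nonzero \<open>a\<close> has an integral
  value and a nonzero \<open>b * \<gamma>\<close> a half-integral one, so they cannot cancel and
  \<open>a + b * \<gamma>\<close> has the value of one of them. Being positive, it is at least one
  half.\<close>

lemma quadratic_value:
  assumes \<gamma>: "\<gamma> ^ 2 = c" and w: "w \<in> quadratic \<gamma>" "w \<in> M"
  shows "w ^ 2 / c \<in> V"
proof -
  have Ucase: "a ^ 2 / c \<in> V" if "a \<in> U" "a \<in> M" for a
  proof -
    have "a * (a / c) \<in> V"
      using uniformizer_divide[OF U.sfield_axioms unif that] that M_V mult_mem by blast
    then show ?thesis by (simp add: power2_eq_square)
  qed
  \<comment> \<open>If \<open>b\<close> were outside \<open>V\<close>, then \<open>1/b\<close>,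
    being in \<open>M\<close>, would be divisible by \<open>c\<close>, and multiplying the square of
    \<open>b * \<gamma>\<close> by \<open>1 / (b^2 c)\<close> would put
    \<open>\<gamma>^2 / c = 1\<close> into \<open>M\<close>.\<close>
  have gcase: "(b * \<gamma>) ^ 2 / c \<in> V" if "b \<in> U" "b * \<gamma> \<in> M" for b
  proof -
    have "b \<in> V"
    proof (rule ccontr)
      assume "b \<notin> V"
      then have "inverse b \<in> M" "b \<noteq> 0" using not_V by auto
      then have "inverse b / c \<in> V"
        using uniformizer_divide[OF U.sfield_axioms unif] that U.inverse_mem by blast
      moreover have "(b * \<gamma>) * (b * \<gamma>) \<in> M" using that M_mult M_V by blast
      ultimately have "((b * \<gamma>) * (b * \<gamma>)) * (inverse b / c * inverse b) \<in> M"
        using \<open>inverse b \<in> M\<close> M_V M_mult mult_mem by blast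
      moreover have "((b * \<gamma>) * (b * \<gamma>)) * (inverse b / c * inverse b) = \<gamma> ^ 2 / c"
        using \<open>b \<noteq> 0\<close> by (simp add: field_simps power2_eq_square)
      ultimately show False using c_facts \<gamma> by simp
    qed
    then have "b * b \<in> V" by (intro mult_mem)
    moreover have "(b * \<gamma>) ^ 2 / c = b * b"
      unfolding power_mult_distrib \<gamma> using c_facts by (simp add: power2_eq_square)
    ultimately show ?thesis by simp
  qed
  obtain a b where ab: "a \<in> U" "b \<in> U" "w = a + b * \<gamma>" using w by (elim quadraticE)
  have g0: "\<gamma> \<noteq> 0" using \<gamma> c_facts by auto
  consider "a = 0" | "b = 0" | "a \<noteq> 0" "b \<noteq> 0" by blast
  then show ?thesis
  proof cases
    case 1
    then show ?thesis using gcase[of b] ab w by simp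
  next
    case 2
    then show ?thesis using Ucase[of a] ab w by simp
  next
    case 3
    \<comment> \<open>Squaring would make an odd power of \<open>c\<close> a unit.\<close>
    have "a / (b * \<gamma>) \<notin> units"
    proof
      assume *: "a / (b * \<gamma>) \<in> units"
      obtain k l :: int where kl: "a / c powi k \<in> units" "b / c powi l \<in> units"
        using unif ab 3 unfolding uniformizer_def by blast
      have "((a / c powi k) / (b / c powi l) / (a / (b * \<gamma>))) ^ 2 \<in> units"
        by (intro units_power units_divide kl *)
      also have "((a / c powi k) / (b / c powi l) / (a / (b * \<gamma>))) ^ 2 = (c powi (l - k)) ^ 2 * \<gamma> ^ 2"
        using 3 c_facts g0 by (simp add: power_int_diff field_simps)
      also have "\<dots> = c powi ((l - k) + (l - k) + 1)"
        unfolding power_int_add[OF disjI1[OF c_facts(3)]] \<gamma> by (simp add: power2_eq_square)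
      finally have "(l - k) + (l - k) + 1 = 0" using units_powi_M(3)[OF c_facts(2,3)] by blast
      then show False by presburger
    qed
    then consider "w / a \<in> units" | "w / (b * \<gamma>) \<in> units"
      using units_add_cases[of a "b * \<gamma>"] 3 g0 ab by auto
    then show ?thesis
    proof cases
      case 1
      then have "w * inverse (w / a) \<in> M" "(w / a) ^ 2 \<in> V"
        using w units_V units_inverse M_mult power_mem by blast+
      moreover have "w * inverse (w / a) = a" using 1 units_nz[OF 1] by (auto simp: field_simps)
      ultimately have "a ^ 2 / c * (w / a) ^ 2 \<in> V" using Ucase[OF ab(1)] mult_mem by metis
      then show ?thesis using 3 by (simp add: power_divide)
    next
      case 2
      then have "w * inverse (w / (b * \<gamma>)) \<in> M" "(w / (b * \<gamma>)) ^ 2 \<in> V"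
        using w units_V units_inverse M_mult power_mem by blast+
      moreover have "w * inverse (w / (b * \<gamma>)) = b * \<gamma>" using 2 units_nz[OF 2] by (auto simp: field_simps)
      ultimately have "(b * \<gamma>) ^ 2 / c * (w / (b * \<gamma>)) ^ 2 \<in> V"
        using gcase[OF ab(2)] mult_mem by metis
      then show ?thesis using 3 g0 by (simp add: power_divide)
    qed
  qed
qed

text \<open>The first assumption says that \<open>w\<close> lies in the field generated by
  \<open>U\<close> and all roots, in a form that applies to \<open>U\<close> itself in residue
  characteristic 2 and to U(sqrt(c)) otherwise.\<close>

lemma trinomial_roots_value:
  assumes F: "\<And>F. sfield F \<Longrightarrow> U \<subseteq> F \<Longrightarrow> {x. \<exists>n\<ge>2. x ^ n = x + 1} \<subseteq> F \<Longrightarrow> w \<in> F"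
    and w: "w \<in> M"
  shows "w ^ 2 / c \<in> V"
proof (cases "2 \<in> M")
  case True
  then have "{x. \<exists>n\<ge>2. x ^ n = x + 1} \<subseteq> U" using trinomial_root_cases by blast
  then have "w \<in> U" using F U.sfield_axioms by blast
  then have "w * (w / c) \<in> V"
    using uniformizer_divide[OF U.sfield_axioms unif _ w] w M_V mult_mem by blast
  then show ?thesis by (simp add: power2_eq_square)
next
  case False
  define \<gamma> where "\<gamma> = csqrt c"
  have \<gamma>: "\<gamma> ^ 2 = c" by (simp add: \<gamma>_def)
  interpret Q: sfield "quadratic \<gamma>" by (rule sfield_quadratic[OF \<gamma>])
  have "x \<in> quadratic \<gamma>" if n: "n \<ge> 2" "x ^ n = x + 1" for x n
  proof (cases "x \<in> U")
    case False
    then obtain a where "a \<in> U" "(x - a) ^ 2 \<in> U" using trinomial_root_cases[OF n] by blast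
    then have "(x - a) + a \<in> quadratic \<gamma>"
      using sqrt_mem_quadratic[OF \<gamma> \<open>2 \<notin> M\<close>] subset_quadratic by (intro Q.add_mem) auto
    then show ?thesis by simp
  qed (use subset_quadratic in blast)
  then have "w \<in> quadratic \<gamma>" using F[OF Q.sfield_axioms subset_quadratic] by blast
  then show ?thesis using quadratic_value[OF \<gamma>] w by blast
qed

end

section \<open>Ramification\<close>

lemma complex_field_simps [simp]:
  "carrier complex_field = UNIV" "\<one>\<^bsub>complex_field\<^esub> = 1" "\<zero>\<^bsub>complex_field\<^esub> = 0"
  "x \<otimes>\<^bsub>complex_field\<^esub> y = x * y" "x \<oplus>\<^bsub>complex_field\<^esub> y = x + y"
  by (simp_all add: ring_of_type_algebra_def)

lemma complex_field_uminus [simp]: "\<ominus>\<^bsub>complex_field\<^esub> x = - x"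
proof -
  interpret C: field complex_field by (rule field_from_type_algebra)
  show ?thesis using C.minus_equality[of "- x" x] by simp
qed

lemma complex_field_inv [simp]: "x \<noteq> 0 \<Longrightarrow> inv\<^bsub>complex_field\<^esub> x = inverse x"
proof -
  interpret C: field complex_field by (rule field_from_type_algebra)
  assume "x \<noteq> 0"
  then show ?thesis using C.comm_inv_char[of x "inverse x"] by simp
qed

lemma complex_field_pow [simp]: "x [^]\<^bsub>complex_field\<^esub> (n::nat) = x ^ n"
proof -
  interpret C: field complex_field by (rule field_from_type_algebra)
  show ?thesis by (induction n) (auto simp: mult.commute)
qed

lemma subfield_iff_sfield: "subfield K complex_field \<longleftrightarrow> sfield K"
proof
  interpret C: field complex_field by (rule field_from_type_algebra)
  {
    assume K: "subfield K complex_field"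
    note r = subfieldE(1)[OF K]
    show "sfield K"
    proof
      show "1 \<in> K" using subringE(3)[OF r] by simp
      fix x y assume xy: "x \<in> K" "y \<in> K"
      show "x * y \<in> K" using subringE(6)[OF r xy] by simp
      show "x - y \<in> K" using subringE(7)[OF r xy(1) subringE(5)[OF r xy(2)]] by simp
    next
      fix x assume "x \<in> K"
      show "inverse x \<in> K"
      proof (cases "x = 0")
        case True
        then show ?thesis using \<open>x \<in> K\<close> by simp
      next
        case False
        then show ?thesis using C.subfield_m_inv(1)[OF K, of x] \<open>x \<in> K\<close> by simp
      qed
    qed
  }
  {
    assume "sfield K"
    then interpret K: sfield K .
    show "subfield K complex_field"
    proof (rule C.subfieldI')
      show "subring K complex_field"
        by (rule C.subringI) (auto intro: K.uminus_mem K.mult_mem K.add_mem)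
    qed (auto intro: K.inverse_mem)
  }
qed

lemma sfield_Rats: "sfield (\<rat> :: complex set)"
  by standard auto

lemma Rats_subset_sfield: "sfield K \<Longrightarrow> \<rat> \<subseteq> (K :: complex set)"
proof
  fix x :: complex assume "sfield K" "x \<in> \<rat>"
  then interpret K: sfield K by simp
  obtain a b where "x = of_int a / of_int b" using \<open>x \<in> \<rat>\<close> by (auto elim: Rats_cases')
  then show "x \<in> K" by (auto intro: K.divide_mem)
qed

lemma generate_field_subset:
  assumes "sfield F" "H \<subseteq> F"
  shows "generate_field complex_field H \<subseteq> F"
proof -
  interpret C: field complex_field by (rule field_from_type_algebra)
  show ?thesis
    using C.generate_field_min_subfield1[of H F] assms by (simp add: subfield_iff_sfield)
qed

lemma sfield_generate_field: "sfield (generate_field complex_field H)"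
proof -
  interpret C: field complex_field by (rule field_from_type_algebra)
  show ?thesis
    using C.generate_field_is_subfield[of H] by (simp add: subfield_iff_sfield)
qed

text \<open>Polynomials of the algebra library are coefficient lists that begin with the leading
  coefficient, hence the reversal.\<close>

lemma eval_complex_field: "ring.eval complex_field p x = poly (Poly (rev p)) x"
proof -
  interpret C: field complex_field by (rule field_from_type_algebra)
  show ?thesis
    by (induction p) (auto simp: Poly_append poly_monom)
qed

lemma polys_iff_coeffs: "0 \<in> A \<Longrightarrow> P \<in> polys A \<longleftrightarrow> set (coeffs P) \<subseteq> A"
proof -
  assume "0 \<in> A"
  have "P \<in> polys A \<longleftrightarrow> range (coeff P) \<subseteq> A" by (auto simp: polys_def)
  with \<open>0 \<in> A\<close> show ?thesis by (simp add: range_coeff)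
qed

lemma Poly_rev_univ_poly:
  assumes "0 \<in> K" "q \<in> carrier (K [X]\<^bsub>complex_field\<^esub>)" "q \<noteq> []"
  shows "Poly (rev q) \<in> polys K" "Poly (rev q) \<noteq> 0"
    "Polynomial.degree (Poly (rev q)) = Polynomials.degree q"
proof -
  have q: "set q \<subseteq> K" "hd q \<noteq> 0"
    using assms(2,3) unfolding univ_poly_carrier[symmetric] polynomial_def by auto
  have "coeffs (Poly (rev q)) = rev q"
    using q(2) assms(3) by (cases q) (simp_all add: coeffs_Poly)
  then show "Poly (rev q) \<in> polys K" "Poly (rev q) \<noteq> 0"
    "Polynomial.degree (Poly (rev q)) = Polynomials.degree q"
    using q assms(1,3) coeffs_eq_Nil[of "Poly (rev q)"]
    by (auto simp: polys_iff_coeffs degree_eq_length_coeffs simp del: coeffs_eq_Nil)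
qed

lemma Irr_poly:
  assumes "sfield K" "ring.algebraic complex_field K x"
  obtains P where "P \<in> polys K" "P \<noteq> 0" "poly P x = 0"
    "Polynomial.degree P = Polynomials.degree (ring.Irr complex_field K x)"
proof -
  interpret C: field complex_field by (rule field_from_type_algebra)
  interpret K: sfield K by fact
  have sK: "subfield K complex_field" using assms by (simp add: subfield_iff_sfield)
  have alg: "(C.algebraic over K) x" using assms by (simp add: over_def)
  define q where "q = C.Irr K x"
  have q: "q \<in> carrier (K [X]\<^bsub>complex_field\<^esub>)" "C.eval q x = 0"
    using C.IrrE[OF sK _ alg] by (auto simp: q_def)
  have "q \<noteq> []"
    using C.IrrE(2)[OF sK _ alg] C.pirreducible_degree[OF sK q(1)] by (auto simp: q_def)
  then show thesis
    using Poly_rev_univ_poly[of K q] q that[of "Poly (rev q)"] by (simp add: eval_complex_field q_def)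
qed

lemma algebraic_poly:
  assumes "sfield K" "P \<in> polys K" "P \<noteq> 0" "poly P x = 0"
  shows "ring.algebraic complex_field K x"
proof -
  interpret C: field complex_field by (rule field_from_type_algebra)
  interpret K: sfield K by fact
  have "rev (coeffs P) \<in> carrier (K [X]\<^bsub>complex_field\<^esub>)"
    unfolding univ_poly_carrier[symmetric] polynomial_def
    using assms(2,3) last_coeffs_eq_coeff_degree[of P] by (auto simp: polys_iff_coeffs hd_rev)
  then have "(C.algebraic over K) x"
    by (rule C.algebraicI) (use assms in \<open>auto simp: eval_complex_field\<close>)
  then show ?thesis by (simp add: over_def)
qed

lemma clear_denominators:
  fixes P :: "'a::field_char_0 poly"
  assumes "P \<in> polys \<rat>"
  shows "\<exists>m::int. m \<noteq> 0 \<and> smult (of_int m) P \<in> polys \<int>"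
  using assms
proof (induction P)
  case 0
  then show ?case by (intro exI[of _ 1]) (auto simp: polys_def)
next
  case (pCons a P)
  interpret Z: sring "\<int> :: 'a set" by standard auto
  have "coeff P i \<in> \<rat>" for i using polysD[OF pCons.prems, of "Suc i"] by simp
  then obtain m :: int where m: "m \<noteq> 0" "smult (of_int m) P \<in> polys \<int>"
    using pCons.IH by (auto simp: polys_def)
  have "a \<in> \<rat>" using polysD[OF pCons.prems, of 0] by simp
  then obtain k n :: int where kn: "n \<noteq> 0" "a = of_int k / of_int n"
    by (metis Rats_cases' less_irrefl)
  have "smult (of_int (m * n)) (pCons a P) = pCons (of_int (m * k)) (smult (of_int n) (smult (of_int m) P))"
    using kn by (simp add: mult.commute)
  also have "\<dots> \<in> polys \<int>" by (intro Z.polys_pCons Z.polys_smult m) auto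
  finally show ?case using m kn by (intro exI[of _ "m * n"]) auto
qed

text \<open>The powers of \<open>y\<close> below the degree of its minimal polynomial are
  independent, so the dimension \<open>n\<close> bounds that degree. A uniform \<open>n\<close> is
  what \<open>exists_uniformizer\<close> needs.\<close>

lemma number_field_bounded_degree:
  assumes "number_field K"
  shows "\<exists>n. \<forall>y\<in>K. \<exists>q. q \<noteq> 0 \<and> Polynomial.degree q \<le> n \<and> poly (map_poly of_int q) y = 0"
proof -
  interpret C: field complex_field by (rule field_from_type_algebra)
  have K: "subfield K complex_field" "C.finite_dimension \<rat> K"
    using assms by (auto simp: number_field_def)
  interpret K: sfield K using K by (simp add: subfield_iff_sfield)
  have Q: "subfield \<rat> complex_field" using sfield_Rats by (simp add: subfield_iff_sfield)
  obtain n where n: "C.dimension n \<rat> K" using C.finite_dimensionE'[OF K(2)] .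
  have "\<exists>q. q \<noteq> 0 \<and> Polynomial.degree q \<le> n \<and> poly (map_poly of_int q) y = 0" if y: "y \<in> K" for y
  proof -
    have alg: "(C.algebraic over \<rat>) y"
      using C.finite_dimension_imp_algebraic[OF Q subfieldE(1)[OF K(1)] K(2) y] .
    define d where "d = Polynomials.degree (C.Irr \<rat> y)"
    have "y \<in> carrier complex_field" by simp
    from C.exp_base_independent[OF Q this alg]
    have ind: "C.independent \<rat> (C.exp_base y d)" by (simp only: d_def)
    have "set (C.exp_base y d) \<subseteq> K" using y by (auto simp: C.exp_base_def intro: K.power_mem)
    then have "length (C.exp_base y d) \<le> n" by (rule C.independent_length_le_dimension[OF Q n ind])
    then have dn: "d \<le> n" by (simp add: C.exp_base_def)
    obtain P where P: "P \<in> polys \<rat>" "P \<noteq> 0" "poly P y = 0" "Polynomial.degree P = d"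
      using Irr_poly[OF sfield_Rats, of y] alg by (auto simp: over_def d_def)
    obtain m :: int where m: "m \<noteq> 0" "smult (of_int m) P \<in> polys \<int>" using clear_denominators P by blast
    obtain q where q: "smult (of_int m) P = map_poly of_int q"
      using intpolyE[OF polysD[OF m(2)]] .
    have "Polynomial.degree q = d"
      using P m arg_cong[OF q, of Polynomial.degree] by (simp add: degree_map_poly)
    moreover have "q \<noteq> 0" using q P m by auto
    moreover have "poly (map_poly of_int q) y = 0" using P by (simp flip: q)
    ultimately show ?thesis using dn by blast
  qed
  then show ?thesis by blast
qed

section \<open>Prime ideals and their powers seen through a valuation ring\<close>

lemma sring_integers: "sfield K \<Longrightarrow> sring {x \<in> K. algebraic_int (x :: complex)}"
proof -
  assume "sfield K"
  then interpret K: sfield K .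
  show ?thesis
  proof
    fix x y assume *: "x \<in> {x \<in> K. algebraic_int x}" "y \<in> {x \<in> K. algebraic_int x}"
    then have "algebraic_int (x + - y)" by (intro algebraic_int_add algebraic_int_minus) auto
    with * show "x - y \<in> {x \<in> K. algebraic_int x}" by (auto intro: K.diff_mem)
    show "x * y \<in> {x \<in> K. algebraic_int x}" using * by (auto intro: K.mult_mem algebraic_int_mult)
  qed auto
qed

lemma ring_of_integers_simps [simp]:
  "carrier (ring_of_integers K) = {x \<in> K. algebraic_int x}" "\<one>\<^bsub>ring_of_integers K\<^esub> = 1"
  "\<zero>\<^bsub>ring_of_integers K\<^esub> = 0"
  "x \<otimes>\<^bsub>ring_of_integers K\<^esub> y = x * y" "x \<oplus>\<^bsub>ring_of_integers K\<^esub> y = x + y"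
  by (simp_all add: ring_of_integers_def ring_of_type_algebra_def)

lemma ideal_power_simps:
  "P [^]\<^bsub>ideals_set R\<^esub> (0::nat) = carrier R"
  "P [^]\<^bsub>ideals_set R\<^esub> Suc n = (P [^]\<^bsub>ideals_set R\<^esub> n) \<cdot>\<^bsub>R\<^esub> P"
  by (simp_all add: nat_pow_def ideals_set_def)

text \<open>Localising first makes the centre of the valuation ring exactly the prime ideal.\<close>
lemma prime_valring:
  assumes L: "sfield L" and B: "primeideal B (ring_of_integers L)"
  obtains V where "valring V" "B \<subseteq> valring.M V" "\<And>x. x \<in> L \<Longrightarrow> algebraic_int x \<Longrightarrow> x \<in> valring.M V \<Longrightarrow> x \<in> B"
proof -
  interpret L: sfield L by fact
  define R where "R = {x \<in> L. algebraic_int x}"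
  interpret R: sring R unfolding R_def by (rule sring_integers) fact
  interpret B: primeideal B "ring_of_integers L" by fact
  have BR: "B \<subseteq> R" using B.a_subset by (simp add: R_def)
  have B1: "1 \<notin> B" using B.I_notcarr B.one_imp_carrier by auto
  have B0: "0 \<in> B"
    using additive_subgroup.zero_closed[OF ideal.axioms(1)[OF B.ideal_axioms]] by simp
  have Badd: "x + y \<in> B" if "x \<in> B" "y \<in> B" for x y
    using additive_subgroup.a_closed[OF ideal.axioms(1)[OF B.ideal_axioms] that] by simp
  have Bmult: "x * y \<in> B" if "x \<in> B" "y \<in> R" for x y using B.I_r_closed[of x y] that by (simp add: R_def)
  have Bprime: "x * y \<notin> B" if "x \<in> R - B" "y \<in> R - B" for x y
    using B.I_prime[of x y] that by (auto simp: R_def)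
  define A where "A = {r / s | r s. r \<in> R \<and> s \<in> R - B}"
  have AI: "r / s \<in> A" if "r \<in> R" "s \<in> R - B" for r s using that by (auto simp: A_def)
  interpret A: sring A
  proof
    show "1 \<in> A" using AI[of 1 1] B1 by simp
    fix x y assume "x \<in> A" "y \<in> A"
    then obtain a b d e where *: "x = a / b" "y = d / e" "a \<in> R" "b \<in> R - B" "d \<in> R" "e \<in> R - B"
      unfolding A_def by blast
    have nz: "b \<noteq> 0" "e \<noteq> 0" using * B0 by auto
    have be: "b * e \<in> R - B" using * Bprime R.mult_mem by blast
    have "(a * e - d * b) / (b * e) \<in> A" "(a * d) / (b * e) \<in> A"
      using * be by (intro AI R.diff_mem R.mult_mem; simp)+
    moreover have "x - y = (a * e - d * b) / (b * e)" "x * y = (a * d) / (b * e)"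
      using nz * by (simp_all add: field_simps)
    ultimately show "x - y \<in> A" "x * y \<in> A" by simp_all
  qed
  have span: "\<exists>b\<in>B. \<exists>s\<in>R - B. z = b / s" if "z \<in> ideal_span A B" for z
    using that
  proof (induction rule: ideal_span.induct)
    case zero
    show ?case using B0 B1 by (intro bexI[of _ 0] bexI[of _ 1]) auto
  next
    case (step p a z)
    then obtain b s r t where *: "b \<in> B" "s \<in> R - B" "z = b / s" "r \<in> R" "t \<in> R - B" "a = r / t"
      unfolding A_def by blast
    have nz: "s \<noteq> 0" "t \<noteq> 0" using * B0 by auto
    have "p * a + z = (p * (r * s) + b * t) / (t * s)"
      unfolding *(3,6) using nz by (simp add: field_simps)
    moreover have "p * (r * s) + b * t \<in> B"
      using * step(1) by (intro Badd Bmult R.mult_mem) auto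
    moreover have "t * s \<in> R - B" using * Bprime R.mult_mem by blast
    ultimately show ?case by blast
  qed
  have "1 \<notin> ideal_span A B"
  proof
    assume "1 \<in> ideal_span A B"
    then obtain b s where "b \<in> B" "s \<in> R - B" "1 = b / s" using span by blast
    then show False using B0 by (auto simp: field_simps)
  qed
  moreover have RA: "R \<subseteq> A" using AI[of _ 1] B1 by auto
  ultimately obtain V where V: "valring V" "A \<subseteq> V" "\<And>p. p \<in> B \<Longrightarrow> p \<noteq> 0 \<Longrightarrow> inverse p \<notin> V"
    using valring_extension[OF A.sring_axioms, of B] BR by blast
  interpret V: valring V by fact
  have "B \<subseteq> V.M" using V BR RA by (auto simp: V.M_def)
  moreover have "x \<in> B" if "x \<in> L" "algebraic_int x" "x \<in> V.M" for x
  proof (rule ccontr)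
    assume "x \<notin> B"
    then have "1 / x \<in> V" "x \<noteq> 0" using AI[of 1 x] that V(2) B0 by (auto simp: R_def)
    then show False using that by (auto simp: V.M_def inverse_eq_divide)
  qed
  ultimately show thesis using that V(1) by blast
qed

text \<open>Among finitely many elements of \<open>B\<close> one divides all the others in
  \<open>V\<close>; a sum of products of \<open>n\<close> elements of \<open>B\<close> is therefore
  a multiple in \<open>V\<close> of the \<open>n\<close>-th power of a single
  \<open>b\<close>.\<close>

lemma (in valring) ideal_power_prod_value:
  assumes "B \<subseteq> V" "B \<noteq> {}" and op: "\<And>x y. x \<otimes>\<^bsub>R\<^esub> y = x * y" "\<And>x y. x \<oplus>\<^bsub>R\<^esub> y = x + y"
    and "carrier R \<subseteq> V"
  shows "z \<in> B [^]\<^bsub>ideals_set R\<^esub> n \<Longrightarrow> \<exists>b\<in>B. \<exists>v\<in>V. z = v * b ^ n"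
    and "J \<subseteq> V \<Longrightarrow> z \<in> (B [^]\<^bsub>ideals_set R\<^esub> n) \<cdot>\<^bsub>R\<^esub> J \<Longrightarrow> \<exists>b\<in>B. \<exists>v\<in>V. z = v * b ^ n"
proof -
  have common: "\<exists>d\<in>{x, y}. \<exists>s\<in>V. \<exists>t\<in>V. x = s * d \<and> y = t * d" for x y
  proof (cases "x = 0 \<or> y = 0")
    case True
    then show ?thesis
      by (metis insertCI mult_zero_left mult_1 one_mem zero_mem)
  next
    case False
    then show ?thesis using divide_total[of x y]
      by (auto intro: bexI[of _ "x / y"] bexI[of _ "y / x"])
  qed
  have add: "\<exists>b\<in>B. \<exists>v\<in>V. z1 + z2 = v * b ^ n"
    if z: "\<exists>b\<in>B. \<exists>v\<in>V. z1 = v * b ^ n" "\<exists>b\<in>B. \<exists>v\<in>V. z2 = v * b ^ n" for z1 z2 n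
  proof -
    obtain b1 b2 v1 v2 where *: "b1 \<in> B" "v1 \<in> V" "z1 = v1 * b1 ^ n" "b2 \<in> B" "v2 \<in> V" "z2 = v2 * b2 ^ n"
      using z by blast
    obtain d s t where d: "d \<in> {b1, b2}" "s \<in> V" "t \<in> V" "b1 = s * d" "b2 = t * d" using common by blast
    have "z1 + z2 = (v1 * s ^ n + v2 * t ^ n) * d ^ n"
      unfolding *(3,6) by (subst d(4), subst d(5)) (simp add: power_mult_distrib algebra_simps)
    moreover have "v1 * s ^ n + v2 * t ^ n \<in> V" using * d by (intro add_mem mult_mem power_mem)
    moreover have "d \<in> B" using * d by auto
    ultimately show ?thesis by blast
  qed
  show pow: "z \<in> B [^]\<^bsub>ideals_set R\<^esub> n \<Longrightarrow> \<exists>b\<in>B. \<exists>v\<in>V. z = v * b ^ n" for z n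
  proof (induction n arbitrary: z)
    case 0
    then have "z \<in> V" using assms by (auto simp only: ideal_power_simps(1))
    then show ?case using \<open>B \<noteq> {}\<close> by auto
  next
    case (Suc n)
    have "z \<in> (B [^]\<^bsub>ideals_set R\<^esub> n) \<cdot>\<^bsub>R\<^esub> B"
      using Suc.prems by (simp only: ideal_power_simps(2))
    then show ?case
    proof (induction rule: ideal_prod.induct)
      case (prod i j)
      obtain b v where *: "b \<in> B" "v \<in> V" "i = v * b ^ n" using Suc.IH prod by blast
      obtain d s t where d: "d \<in> {b, j}" "s \<in> V" "t \<in> V" "b = s * d" "j = t * d" using common by blast
      have "i \<otimes>\<^bsub>R\<^esub> j = (v * s ^ n * t) * d ^ Suc n"
        unfolding op *(3) by (subst d(4), subst d(5)) (simp add: power_mult_distrib algebra_simps)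
      moreover have "v * s ^ n * t \<in> V" using * d by (intro mult_mem power_mem)
      moreover have "d \<in> B" using * d prod by auto
      ultimately show ?case by blast
    next
      case (sum s1 s2)
      then show ?case unfolding op by (intro add)
    qed
  qed
  show "\<exists>b\<in>B. \<exists>v\<in>V. z = v * b ^ n" if "J \<subseteq> V" "z \<in> (B [^]\<^bsub>ideals_set R\<^esub> n) \<cdot>\<^bsub>R\<^esub> J"
    using that(2)
  proof (induction rule: ideal_prod.induct)
    case (prod i j)
    obtain b v where *: "b \<in> B" "v \<in> V" "i = v * b ^ n" using pow prod by blast
    then have "i \<otimes>\<^bsub>R\<^esub> j = (v * j) * b ^ n" by (simp add: op algebra_simps)
    moreover have "v * j \<in> V" using * prod \<open>J \<subseteq> V\<close> by (intro mult_mem) auto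
    ultimately show ?case using * by blast
  next
    case (sum s1 s2)
    then show ?case unfolding op by (intro add)
  qed
qed

abbreviation trinomial_roots :: "complex set" where
  "trinomial_roots \<equiv> {x. \<exists>n\<ge>2. x ^ n = x + 1}"

lemma ramification_index_le_2:
  assumes K: "number_field K" and KL: "finite_field_extension K L"
    and LS: "L \<subseteq> generate_field complex_field (K \<union> trinomial_roots)"
    and B: "B \<in> nonzero_primes L"
  shows "ramification_index K L B \<le> enat 2"
proof -
  interpret C: field complex_field by (rule field_from_type_algebra)
  have Lf: "sfield L" "K \<subseteq> L" using KL by (auto simp: finite_field_extension_def subfield_iff_sfield)
  have Kf: "sfield K" using K by (auto simp: number_field_def subfield_iff_sfield)
  interpret L: sfield L by fact
  have BP: "primeideal B (ring_of_integers L)" "B \<noteq> {0}" using B by (auto simp: nonzero_primes_def)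
  interpret BB: primeideal B "ring_of_integers L" by (rule BP)
  obtain V where V: "valring V" "B \<subseteq> valring.M V"
    "\<And>x. x \<in> L \<Longrightarrow> algebraic_int x \<Longrightarrow> x \<in> valring.M V \<Longrightarrow> x \<in> B"
    using prime_valring[OF Lf(1) BP(1)] by blast
  interpret V: valring V by (rule V)
  have OV: "{x \<in> L. algebraic_int x} \<subseteq> V" using algebraic_int_mem_valring[OF V(1)] by blast
  have "0 \<in> B"
    using additive_subgroup.zero_closed[OF ideal.axioms(1)[OF BB.ideal_axioms]] by simp
  then obtain b where "b \<in> B" "b \<noteq> 0" using BP by auto
  moreover have "algebraic_int b" using BB.a_subset \<open>b \<in> B\<close> by auto
  ultimately obtain p :: nat where p: "prime p" "of_nat p \<in> V.M"
    using exists_prime_M[OF V(1), of b] V(2) by auto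
  interpret V: cvalring V p by unfold_locales (rule p)+
  obtain n where n: "\<And>y. y \<in> K \<Longrightarrow> \<exists>q. q \<noteq> 0 \<and> Polynomial.degree q \<le> n \<and> poly (map_poly of_int q) y = 0"
    using number_field_bounded_degree[OF K] by blast
  have Kalg: "K \<subseteq> {x. algebraic x}"
  proof
    fix y assume "y \<in> K"
    then obtain q where "q \<noteq> 0" "poly (map_poly of_int q) y = 0" using n by blast
    then have "algebraic y"
      by (intro algebraicI[of "map_poly of_int q"]) (auto simp: coeff_map_poly map_poly_eq_0_iff)
    then show "y \<in> {x. algebraic x}" by simp
  qed
  obtain c where c: "V.uniformizer c K" "algebraic_int c"
    using V.exists_integral_uniformizer[OF Kf n] by blast
  have cK: "c \<in> K" "c \<in> V.M" "c \<noteq> 0" using c by (auto simp: V.uniformizer_def)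
  then have cB: "c \<in> B \<inter> K" using V(3) Lf c by auto
  obtain U where U: "K \<subseteq> U" "strictly_henselian V p U c"
    using V.strictly_henselian_extension[OF Kf c(1) Kalg] by blast
  interpret U: strictly_henselian V p U c by (rule U)
  have "enat m \<le> enat 2" if J: "ideal J (ring_of_integers L)"
    "Idl\<^bsub>ring_of_integers L\<^esub> (B \<inter> K) = (B [^]\<^bsub>ideals_set (ring_of_integers L)\<^esub> m) \<cdot>\<^bsub>ring_of_integers L\<^esub> J" for m J
  proof (rule ccontr)
    assume "\<not> enat m \<le> enat 2"
    \<comment> \<open>So \<open>m = e + 3\<close>. From \<open>c = v b^m\<close> and
      \<open>b^2 / c\<close> in \<open>V\<close> follows \<open>1 = b (v b^e) (b^2 / c)\<close>, and
      the third factor \<open>b\<close> forces this into \<open>M\<close>.\<close>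
    then obtain e where e: "m = Suc (Suc (Suc e))" by (metis enat_ord_simps(1) not_less_eq_eq numeral_2_eq_2 Suc_le_D)
    interpret J: ideal J "ring_of_integers L" by (rule J)
    have "B \<inter> K \<subseteq> carrier (ring_of_integers L)" using BB.a_subset by blast
    then have "c \<in> Idl\<^bsub>ring_of_integers L\<^esub> (B \<inter> K)" using cB BB.genideal_self by blast
    then have "c \<in> (B [^]\<^bsub>ideals_set (ring_of_integers L)\<^esub> m) \<cdot>\<^bsub>ring_of_integers L\<^esub> J" by (simp add: J(2))
    moreover have "B \<subseteq> V" "J \<subseteq> V" "B \<noteq> {}" using BB.a_subset J.a_subset OV cB by auto
    ultimately obtain b v where b: "b \<in> B" "v \<in> V" "c = v * b ^ m"
      using V.ideal_power_prod_value(2)[of B "ring_of_integers L" J c m] OV by auto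
    have "b \<in> L" using b BB.a_subset by auto
    have bM: "b \<in> V.M" using b V(2) by auto
    have "b ^ 2 / c \<in> V"
    proof (rule U.trinomial_roots_value[OF _ bM])
      fix F assume "sfield F" "U \<subseteq> F" "trinomial_roots \<subseteq> F"
      then have "generate_field complex_field (K \<union> trinomial_roots) \<subseteq> F"
        using U(1) by (intro generate_field_subset) auto
      then show "b \<in> F" using LS \<open>b \<in> L\<close> by blast
    qed
    then have "b * ((v * b ^ e) * (b ^ 2 / c)) \<in> V.M"
      using bM b V.M_V by (intro V.M_mult V.mult_mem V.power_mem) auto
    also have "b * ((v * b ^ e) * (b ^ 2 / c)) = (v * b ^ m) / c"
      by (simp add: e power2_eq_square)
    also have "\<dots> = 1" using b(3) cK(3) by simp
    finally show False by simp
  qed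
  \<comment> \<open>Bounding every admissible exponent bounds the supremum, which also excludes the
    value infinity.\<close>
  then show ?thesis
    unfolding ramification_index_def ideal_exponent_def by (intro Sup_least) blast
qed

section \<open>Heights\<close>

lemma trinomial_root_integral:
  assumes "n \<ge> 2" "(x::complex) ^ n = x + 1"
  shows "algebraic_int x" "algebraic_int (inverse x)" "x \<noteq> 0"
proof -
  show x0: "x \<noteq> 0" using assms by (auto simp: power_0_left)
  have l: "lead_coeff (monom 1 n - [:1, 1::complex:]) = 1"
  proof -
    have "degree (monom 1 n - [:1, 1::complex:]) = n"
      using degree_add_eq_left[of "- [:1, 1:]" "monom (1::complex) n"] assms(1)
      unfolding degree_minus diff_conv_add_uminus by (simp add: degree_monom_eq)
    then show ?thesis using assms(1) by (auto simp: coeff_pCons split: nat.splits)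
  qed
  show "algebraic_int x"
    by (rule algebraic_int.intros[OF l])
      (use assms in \<open>auto simp: poly_monom coeff_pCons split: nat.splits\<close>)
  \<comment> \<open>The constant coefficient \<open>1\<close> makes the reversed polynomial
    monic.\<close>
  show "algebraic_int (inverse x)"
    by (rule algebraic_int_inverse[of "[:1, 1:] - monom 1 n"])
      (use assms in \<open>auto simp: poly_monom coeff_pCons split: nat.splits\<close>)
qed

text \<open>Above \<open>2\<close> the inequality \<open>norm x ^ 2 <= norm x + 1\<close> fails. The
  bound is crude; what matters is that it does not depend on \<open>n\<close>.\<close>

lemma norm_trinomial_root_le_2:
  assumes "n \<ge> 2" "(x::complex) ^ n = x + 1"
  shows "norm x \<le> 2"
proof (rule ccontr)
  assume "\<not> norm x \<le> 2"
  then have g: "norm x > 2" by simp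
  have "norm x ^ n \<le> norm x + 1"
    using norm_triangle_ineq[of x 1] by (simp flip: norm_power add: assms(2))
  moreover have "norm x ^ 2 \<le> norm x ^ n" using g assms(1) by (intro power_increasing) auto
  moreover have "norm x * norm x > 2 * norm x" using g by (intro mult_strict_right_mono) auto
  ultimately show False using g by (simp add: power2_eq_square)
qed

text \<open>
  For a unit, numerator and denominator of any representation generate the same ideal, so no
  finiteness of the exponents is needed (the junk value 0 / 0 = 0 is harmless as well).
\<close>
lemma adic_abs_unit_le_1:
  assumes K: "sfield K" and x: "x \<in> K" "algebraic_int x" "algebraic_int (inverse x)" "x \<noteq> 0"
  shows "adic_abs K P x \<le> 1"
proof -
  interpret K: sfield K by fact
  let ?R = "ring_of_integers K"
  define Q where "Q = (\<lambda>(a, b). a \<in> carrier ?R \<and> b \<in> carrier ?R \<and> b \<noteq> 0 \<and> x = a / b)"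
  have "Q (x, 1)" using x by (simp add: Q_def)
  then have "Q (SOME ab. Q ab)" by (rule someI)
  moreover obtain a b where ab: "(SOME ab. Q ab) = (a, b)" by fastforce
  ultimately have q: "a \<in> carrier ?R" "b \<in> carrier ?R" "b \<noteq> 0" "x = a / b" by (auto simp: Q_def)
  then have axb: "a = x * b" by simp
  have "PIdl\<^bsub>?R\<^esub> a = PIdl\<^bsub>?R\<^esub> b"
  proof (intro equalityI subsetI)
    fix z assume "z \<in> PIdl\<^bsub>?R\<^esub> a"
    then obtain r where r: "r \<in> K" "algebraic_int r" "z = r * a" by (auto simp: cgenideal_def)
    then have "z = (r * x) * b" by (simp add: axb)
    moreover have "r * x \<in> K" "algebraic_int (r * x)" using r x K.mult_mem algebraic_int_mult by auto
    ultimately show "z \<in> PIdl\<^bsub>?R\<^esub> b" by (auto simp: cgenideal_def)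
  next
    fix z assume "z \<in> PIdl\<^bsub>?R\<^esub> b"
    then obtain r where r: "r \<in> K" "algebraic_int r" "z = r * b" by (auto simp: cgenideal_def)
    then have "z = (r * inverse x) * a" using x by (simp add: axb)
    moreover have "r * inverse x \<in> K" "algebraic_int (r * inverse x)"
      using r x K.mult_mem K.inverse_mem algebraic_int_mult by auto
    ultimately show "z \<in> PIdl\<^bsub>?R\<^esub> a" unfolding cgenideal_def by auto
  qed
  then have "adic_abs_int K P a = adic_abs_int K P b"
    using x q by (simp add: adic_abs_int_def)
  then show ?thesis
    using ab unfolding adic_abs_def Q_def by (simp add: Let_def case_prod_unfold divide_le_eq_1)
qed

section \<open>Embeddings and the archimedean part of the height\<close>

lemma embedding_hom:
  assumes "sfield K" "\<sigma> \<in> embeddings K"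
  shows "\<And>a b. a \<in> K \<Longrightarrow> b \<in> K \<Longrightarrow> \<sigma> (a + b) = \<sigma> a + \<sigma> b"
    and "\<And>a b. a \<in> K \<Longrightarrow> b \<in> K \<Longrightarrow> \<sigma> (a * b) = \<sigma> a * \<sigma> b"
    and "\<sigma> 1 = 1" and "\<sigma> 0 = 0"
    and "\<And>a. a \<in> K \<Longrightarrow> \<sigma> (- a) = - \<sigma> a"
    and "\<And>a. a \<in> K \<Longrightarrow> \<sigma> (inverse a) = inverse (\<sigma> a)"
    and "\<And>a n. a \<in> K \<Longrightarrow> \<sigma> (a ^ n) = \<sigma> a ^ n"
    and "\<And>q. q \<in> \<rat> \<Longrightarrow> \<sigma> q = q"
    and "\<And>P a. P \<in> polys \<rat> \<Longrightarrow> a \<in> K \<Longrightarrow> \<sigma> (poly P a) = poly P (\<sigma> a)"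
proof -
  interpret K: sfield K by fact
  have h: "\<sigma> \<in> ring_hom (complex_field\<lparr>carrier := K\<rparr>) complex_field"
    using assms(2) by (simp add: embeddings_def)
  show add: "\<sigma> (a + b) = \<sigma> a + \<sigma> b" if "a \<in> K" "b \<in> K" for a b
    using ring_hom_add[OF h, of a b] that by simp
  show mult: "\<sigma> (a * b) = \<sigma> a * \<sigma> b" if "a \<in> K" "b \<in> K" for a b
    using ring_hom_mult[OF h, of a b] that by simp
  show one: "\<sigma> 1 = 1" using ring_hom_one[OF h] by simp
  show zero: "\<sigma> 0 = 0" using add[of 0 0] by simp
  show minus: "\<sigma> (- a) = - \<sigma> a" if "a \<in> K" for a
    using add[of a "- a"] that zero K.uminus_mem by (simp add: add_eq_0_iff)
  show inv: "\<sigma> (inverse a) = inverse (\<sigma> a)" if "a \<in> K" for a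
  proof (cases "a = 0")
    case False
    then have "\<sigma> a * \<sigma> (inverse a) = 1" using mult[of a "inverse a"] that K.inverse_mem one by simp
    then show ?thesis by (rule inverse_unique[symmetric])
  qed (simp add: zero)
  show "\<sigma> (a ^ n) = \<sigma> a ^ n" if "a \<in> K" for a n
    by (induction n) (use that one mult K.power_mem in auto)
  have nat: "\<sigma> (of_nat n) = of_nat n" for n
    by (induction n) (auto simp: zero one add)
  have int: "\<sigma> (of_int n) = of_int n" for n
  proof (cases n)
    case (neg k)
    then have "of_int n = - (of_nat (Suc k) :: complex)" by simp
    then show ?thesis by (simp only: minus[OF K.of_nat_mem] nat)
  qed (simp add: nat)
  show rat: "\<sigma> q = q" if q: "q \<in> \<rat>" for q
  proof -
    obtain a b where "q = of_int a * inverse (of_int b)"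
      using q by (metis Rats_cases' divide_inverse)
    then show ?thesis
      using mult[OF K.of_int_mem K.inverse_mem[OF K.of_int_mem]] inv[OF K.of_int_mem] int by simp
  qed
  show "\<sigma> (poly P a) = poly P (\<sigma> a)" if "P \<in> polys \<rat>" "a \<in> K" for P a
    using that(1)
  proof (induction P)
    case (pCons c P)
    have c: "c \<in> \<rat>" using polysD[OF pCons.prems, of 0] by simp
    have "coeff P i \<in> \<rat>" for i using polysD[OF pCons.prems, of "Suc i"] by simp
    then have P: "P \<in> polys \<rat>" by (simp add: polys_def)
    have QK: "\<rat> \<subseteq> K" by (rule Rats_subset_sfield) fact
    then have "poly P a \<in> K" by (intro K.poly_mem[OF subsetD[OF polys_mono P]] that(2))
    moreover have "c \<in> K" using c QK by blast
    ultimately show ?case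
      using pCons.IH[OF P] rat[OF c] add[of c "a * poly P a"] mult[OF that(2)] K.mult_mem[OF that(2)] by simp
  qed (simp add: zero)
qed

text \<open>An embedding is determined by the image of \<open>x\<close>, which is a root of the
  minimal polynomial, and the degree of the latter is the dimension. The inequality suffices because
  heights are only bounded from above by it.\<close>

lemma embeddings_card_le_dim:
  assumes "algebraic x"
  shows "card (embeddings (generate_field complex_field {x})) \<le>
    ring.dim complex_field \<rat> (generate_field complex_field {x})"
proof -
  interpret C: field complex_field by (rule field_from_type_algebra)
  define K where "K = generate_field complex_field {x}"
  have K: "sfield K" unfolding K_def by (rule sfield_generate_field)
  interpret K: sfield K by fact
  have xK: "x \<in> K" unfolding K_def by (auto intro: generate_field.incl)
  have Q: "subfield \<rat> complex_field" using sfield_Rats by (simp add: subfield_iff_sfield)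
  have xc: "x \<in> carrier complex_field" by simp
  obtain P0 where "P0 \<in> polys \<rat>" "P0 \<noteq> 0" "poly P0 x = 0"
    using assms unfolding algebraic_altdef polys_def by blast
  then have "C.algebraic \<rat> x" by (rule algebraic_poly[OF sfield_Rats])
  then have alg: "(C.algebraic over \<rat>) x" by (simp add: over_def)
  have E: "subfield (C.simple_extension \<rat> x) complex_field"
    using C.simple_extension_is_subfield[OF Q xc] alg by blast
  have "C.simple_extension \<rat> x \<subseteq> K"
    by (rule C.simple_extension_subring_incl)
      (use K xK Rats_subset_sfield[OF K] in \<open>auto simp: subfield_iff_sfield[symmetric] intro: subfieldE(1)\<close>)
  moreover have "K \<subseteq> C.simple_extension \<rat> x"
    unfolding K_def
  proof (rule generate_field_subset)
    show "sfield (C.simple_extension \<rat> x)" using E by (simp add: subfield_iff_sfield)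
    show "{x} \<subseteq> C.simple_extension \<rat> x"
      using C.simple_extension_mem[OF subfieldE(1)[OF Q] xc] by simp
  qed
  ultimately have KE: "K = C.simple_extension \<rat> x" by blast
  have dim: "C.dim \<rat> K = Polynomials.degree (C.Irr \<rat> x)"
    using C.simple_extension_dim[OF Q xc alg] by (simp add: over_def KE)
  obtain P where P: "P \<in> polys \<rat>" "P \<noteq> 0" "poly P x = 0"
    "Polynomial.degree P = Polynomials.degree (C.Irr \<rat> x)"
    using Irr_poly[OF sfield_Rats, of x] alg by (auto simp: over_def)
  have "card (embeddings K) \<le> card {z. poly P z = 0}"
  proof (rule card_inj_on_le)
    show "finite {z. poly P z = 0}" using P poly_roots_finite by blast
    show "(\<lambda>\<sigma>. \<sigma> x) ` embeddings K \<subseteq> {z. poly P z = 0}"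
    proof safe
      fix \<sigma> assume "\<sigma> \<in> embeddings K"
      then show "poly P (\<sigma> x) = 0"
        using embedding_hom(4,9)[OF K, of \<sigma>] P xK by metis
    qed
    show "inj_on (\<lambda>\<sigma>. \<sigma> x) (embeddings K)"
    proof (rule inj_onI)
      fix \<sigma> \<tau> assume st: "\<sigma> \<in> embeddings K" "\<tau> \<in> embeddings K" and eq: "\<sigma> x = \<tau> x"
      note s = embedding_hom[OF K st(1)] and t = embedding_hom[OF K st(2)]
      have "y \<in> K \<and> \<sigma> y = \<tau> y" if "y \<in> generate_field complex_field {x}" for y
        using that
      proof (induction rule: generate_field.induct)
        case (m_inv h)
        then show ?case using s(6) t(6) K.inverse_mem by auto
      qed (use s t xK eq in \<open>auto intro: K.uminus_mem K.add_mem K.mult_mem\<close>)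
      then have "\<sigma> y = \<tau> y" if "y \<in> K" for y using that unfolding K_def by blast
      moreover have "\<sigma> \<in> extensional K" "\<tau> \<in> extensional K" using st by (auto simp: embeddings_def)
      ultimately show "\<sigma> = \<tau>" by (intro extensionalityI)
    qed
  qed
  also have "\<dots> \<le> Polynomial.degree P" using P(2) by (rule card_poly_roots_bound)
  finally show ?thesis using P dim by (simp add: K_def)
qed

text \<open>The finite places contribute nothing, as \<open>x\<close> is a unit. Every
  \<open>\<sigma> x\<close> is a root of the same trinomial, so at most \<open>d\<close> terms, each
  at most \<open>ln 2\<close>, are divided by \<open>d\<close>.\<close>

lemma weil_height_trinomial_root:
  assumes n: "n \<ge> 2" "x ^ n = x + 1"
  shows "0 \<le> weil_height x" "weil_height x \<le> ln 2"
proof -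
  define K where "K = generate_field complex_field {x}"
  have K: "sfield K" unfolding K_def by (rule sfield_generate_field)
  have xK: "x \<in> K" unfolding K_def by (auto intro: generate_field.incl)
  note x = trinomial_root_integral[OF n]
  define d where "d = ring.dim complex_field \<rat> K"
  have d: "card (embeddings K) \<le> d"
    unfolding d_def K_def by (rule embeddings_card_le_dim) (use x in blast)
  have "ln (max 1 (adic_abs K P x)) = 0" for P
    using adic_abs_unit_le_1[OF K xK x, of P] by simp
  then have h: "weil_height x = (\<Sum>\<sigma>\<in>embeddings K. ln (max 1 (norm (\<sigma> x)))) / real d"
    unfolding weil_height_def weil_height_over_def K_def[symmetric] d_def by simp
  have "ln (max 1 (norm (\<sigma> x))) \<le> ln 2" if \<sigma>: "\<sigma> \<in> embeddings K" for \<sigma>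
  proof -
    note e = embedding_hom[OF K \<sigma>]
    interpret K: sfield K by (rule K)
    have "\<sigma> x ^ n = \<sigma> (x ^ n)" using e(7) xK by simp
    also have "\<dots> = \<sigma> x + 1" using n(2) e(1)[OF xK K.one_mem] e(3) by simp
    finally have "norm (\<sigma> x) \<le> 2" by (rule norm_trinomial_root_le_2[OF n(1)])
    then show ?thesis by (subst ln_le_cancel_iff) auto
  qed
  then have "(\<Sum>\<sigma>\<in>embeddings K. ln (max 1 (norm (\<sigma> x)))) \<le> of_nat (card (embeddings K)) * ln 2"
    by (rule sum_bounded_above)
  also have "\<dots> \<le> real d * ln 2" using d by (intro mult_right_mono) auto
  \<comment> \<open>For \<open>d = 0\<close> the quotient is \<open>0\<close> by the convention on
    division.\<close>
  finally show "weil_height x \<le> ln 2"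
    unfolding h by (cases "d = 0") (auto simp: field_simps)
  show "0 \<le> weil_height x" unfolding h by (intro divide_nonneg_nonneg sum_nonneg) auto
qed

text \<open>Each trinomial has a real root above \<open>1\<close>. A root common to two of them
  would have equal powers with different exponents.\<close>

lemma infinite_trinomial_roots: "infinite trinomial_roots"
proof -
  have "\<exists>x::real. 1 < x \<and> x ^ n = x + 1" if "n \<ge> 2" for n
  proof -
    \<comment> \<open>At \<open>1\<close> the function \<open>x^n - x\<close> is \<open>0\<close>,
      at \<open>2\<close> it is at least \<open>2\<close>, so it takes the value \<open>1\<close> in
      between.\<close>
    have "(2::real) ^ 2 \<le> 2 ^ n" using that by (intro power_increasing) auto
    then have "\<exists>x\<ge>1. x \<le> 2 \<and> x ^ n - x = (1::real)"
      by (intro IVT') (auto intro!: continuous_intros)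
    then obtain x :: real where "x \<ge> 1" "x ^ n - x = 1" by blast
    moreover from this have "x \<noteq> 1" by auto
    ultimately show ?thesis by (intro exI[of _ x]) auto
  qed
  then obtain f :: "nat \<Rightarrow> real" where f: "\<And>n. n \<ge> 2 \<Longrightarrow> 1 < f n \<and> f n ^ n = f n + 1" by metis
  define g where "g = (\<lambda>n. complex_of_real (f (n + 2)))"
  have "inj g"
  proof (rule injI)
    fix n m assume "g n = g m"
    then have "f (n + 2) = f (m + 2)" by (simp add: g_def)
    then have "f (n + 2) ^ (n + 2) = f (n + 2) ^ (m + 2)" using f[of "n + 2"] f[of "m + 2"] by simp
    moreover have "1 < f (n + 2)" using f[of "n + 2"] by simp
    ultimately have "n + 2 = m + 2" by (simp only: power_inject_exp)
    then show "n = m" by simp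
  qed
  moreover have "range g \<subseteq> trinomial_roots"
  proof safe
    fix n
    have "g n ^ (n + 2) = complex_of_real (f (n + 2) ^ (n + 2))" by (simp add: g_def)
    also have "\<dots> = g n + 1" using f[of "n + 2"] by (simp add: g_def)
    finally show "\<exists>k\<ge>2. g n ^ k = g n + 1" by (intro exI[of _ "n + 2"]) auto
  qed
  ultimately show ?thesis using range_inj_infinite infinite_super by blast
qed

theorem proposition7p2:
  shows "\<exists>(S :: complex set) (E :: nat).
           S \<subseteq> {x. algebraic x} \<and> infinite S \<and> \<bar>northcott_number S\<bar> \<noteq> \<infinity> \<and>
           (\<forall>K L. number_field K \<longrightarrow> finite_field_extension K L \<longrightarrow>
                  L \<subseteq> generate_field complex_field (K \<union> S) \<longrightarrow>
                  (\<forall>B \<in> nonzero_primes L. ramification_index K L B \<le> enat E))"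
proof (intro exI conjI allI impI ballI)
  show "trinomial_roots \<subseteq> {x. algebraic x}" using trinomial_root_integral(1) by blast
  show "infinite trinomial_roots" by (rule infinite_trinomial_roots)
  define T where "T = {ereal t | t. infinite {x \<in> trinomial_roots. weil_height x \<le> t}}"
  have "{x \<in> trinomial_roots. weil_height x \<le> ln 2} = trinomial_roots"
    using weil_height_trinomial_root(2) by auto
  then have "ereal (ln 2) \<in> T" using infinite_trinomial_roots unfolding T_def by auto
  then have "Inf T \<le> ereal (ln 2)" by (rule Inf_lower)
  \<comment> \<open>Finiteness in \<open>ereal\<close> has two sides: \<open>ln 2\<close> bounds the
    infimum from above, and nonnegativity of the heights excludes minus infinity.\<close>
  moreover have "0 \<le> t" if t: "t \<in> T" for t
  proof -
    obtain r where r: "t = ereal r" "infinite {x \<in> trinomial_roots. weil_height x \<le> r}"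
      using t by (auto simp: T_def)
    then obtain x where "x \<in> trinomial_roots" "weil_height x \<le> r"
      by (metis (mono_tags, lifting) Collect_empty_eq finite.emptyI)
    then have "0 \<le> r" using weil_height_trinomial_root(1) by force
    then show ?thesis using r by simp
  qed
  then have "0 \<le> Inf T" by (rule Inf_greatest)
  ultimately show "\<bar>northcott_number trinomial_roots\<bar> \<noteq> \<infinity>"
    unfolding northcott_number_def T_def[symmetric] by (cases "Inf T") auto
qed (rule ramification_index_le_2)

end
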